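(* Let $\beta>0$, $q>1$, $t>\beta+1$, $\sigma>1$, and let $\mu$ be a positive Borel measure on $\mathbb{D}$; fix $\tau>0$. Then there is a constant $C>0$ such that for every analytic function $f$ on $\mathbb{D}$ $$\Big\| \xi\mapsto\int_{\Gamma_\sigma(\xi)} \frac{(1-|z|)^t|f(z)|}{1-|z|}\, d\mu(z)\Big\|_{L^{q,\infty}(\mathbb{T})} \le C\sup_{z\in\mathbb{D}} |f(z)|(1-|z|)^\beta$$ if and only if $$\Big\| \xi\mapsto\int_{\Gamma_\sigma(\xi)} (1-|z|)^{t-1}\,\mu(D(z,\tau))\,\frac{(1-|z|)^{-\beta}}{(1-|z|)^2}\, dm_2(z)\Big\|_{L^{q,\infty}(\mathbb{T})} <\infty .$$
   Context: $\mathbb{D}$ is the unit disk, $\mathbb{T}$ the unit circle, $dm_2$ normalized area measure on $\mathbb{D}$, $dm$ Lebesgue arc-length measure on $\mathbb{T}$. The Lusin cone is $\Gamma_\sigma(\xi)=\{z\in\mathbb{D}: |1-\bar\xi z|<\sigma(1-|z|)\}$ for $\xi\in\mathbb{T}$. $L^{q,\infty}(\mathbb{T})$ is the weak $L^q$ (Lorentz) space with quasinorm $\|g\|_{L^{q,\infty}}=\sup_{\lambda>0}\lambda\, m(\{\xi:|g(\xi)|>\lambda\})^{1/q}$. For $a\in\mathbb{D}$, $\varphi_a(z)=\frac{a-z}{1-\bar a z}$; the Bergman distance is $d(z,w)=\frac12\log\frac{1+|\varphi_w(z)|}{1-|\varphi_w(z)|}$, and $D(a,\tau)=\{w\in\mathbb{D}: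 d(w,a)<\tau\}$. *)

theory Defs
  imports "HOL-Analysis.Analysis"
begin

definition unit_disk :: "complex set" where
  "unit_disk = ball 0 1"

definition lusin_cone :: "real \<Rightarrow> complex \<Rightarrow> complex set" where
  "lusin_cone \<sigma> \<xi> = {z \<in> unit_disk. cmod (1 - cnj \<xi> * z) < \<sigma> * (1 - cmod z)}"

definition moebius :: "complex \<Rightarrow> complex \<Rightarrow> complex" where
  "moebius a z = (a - z) / (1 - cnj a * z)"

definition bergman_dist :: "complex \<Rightarrow> complex \<Rightarrow> real" where
  "bergman_dist z w = ln ((1 + cmod (moebius w z)) / (1 - cmod (moebius w z))) / 2"

definition bergman_disk :: "complex \<Rightarrow> real \<Rightarrow> complex set" where
  "bergman_disk a \<tau> = {w \<in> unit_disk. bergman_dist w a < \<tau>}"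

definition area_measure :: "complex measure" where
  "area_measure = density lborel (\<lambda>z. ennreal (indicator unit_disk z / pi))"

definition circle_measure :: "complex measure" where
  "circle_measure = distr (restrict_space lborel {0..<2*pi}) borel cis"

definition weak_Lq_norm :: "real \<Rightarrow> (complex \<Rightarrow> ennreal) \<Rightarrow> ennreal" where
  "weak_Lq_norm q g =
     (SUP s\<in>{0<..}. ennreal (s * (measure circle_measure {\<xi> \<in> space circle_measure. g \<xi> > ennreal s}) powr (1/q)))"

end

theory Submission
  imports Defs "HOL-Complex_Analysis.Complex_Analysis"
begin

text \<open>
  Write \<open>x = 1 - |z|\<close> and \<open>A \<sigma> \<xi>\<close> for the integral of \<open>x powr (t - 1 - \<beta>)\<close> over the cone
  \<open>lusin_cone \<sigma> \<xi>\<close> with respect to \<open>\<mu>\<close>. Both conditions are equivalent to \<open>A \<sigma>\<close> lying in weak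
  \<open>L\<^sup>q\<close>. For the first one, two lacunary series and the constant \<open>1\<close> have absolute values whose sum
  is comparable to \<open>x powr (- \<beta>)\<close>. For the second one, Fubini's theorem compares the averaged
  integral pointwise, from above and below, with \<open>A\<close> at slightly different apertures. The aperture
  is irrelevant for weak \<open>L\<^sup>q\<close> bounds when \<open>q > 1\<close>: testing \<open>A \<sigma>2\<close> against the indicator of a
  set \<open>E\<close>, the shadow of a point with aperture \<open>\<sigma>2\<close> meets \<open>E\<close> in a set whose measure is at most a weighted
  dyadic sum of the measures in which its \<open>\<sigma>1\<close>-shadow meets superlevel sets of the maximal function
  of \<open>E\<close>.
  The weak type (1,1) estimate for the latter and Kolmogorov's inequality for \<open>A \<sigma>1\<close> make that sum
  converge geometrically.
\<close>

section \<open>Arc length on the circle\<close>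

text \<open>No finiteness is assumed of \<open>\<mu>\<close>, while Fubini's theorem needs
  \<sigma>-finiteness. Each condition supplies it: a point all of whose neighbourhoods have infinite
  mass would make the integral infinite on a whole arc, which a weak bound forbids, and Lindelof's
  theorem passes from local finiteness to \<sigma>-finiteness.

  The geometric convergence in the change of aperture has a precise rate. The superlevel set at a
  height of order 2^-k has measure at most a constant times 2^k m(E), where m is arc length.
  Kolmogorov's inequality raises this to the power 1 - 1/q, and the weight 2^-k then leaves the
  ratio 2^(-1/q).

  No single analytic function can replace the three test functions. If |f| \<ge> c x^(-\<beta>) held
  throughout the disk, 1/f would be analytic and tend to 0 at the boundary, against the maximum
  principle. A gap series is bounded below only where one of its terms dominates; the exponents of
  the two series interlace so that these regions together cover a neighbourhood of the boundary, and
  the constant covers the rest.\<close>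

lemma space_circle_measure [simp]: "space circle_measure = UNIV"
  by (simp add: circle_measure_def)

lemma sets_circle_measure [simp, measurable_cong]: "sets circle_measure = sets borel"
  by (simp add: circle_measure_def)

lemma cis_borel_measurable [measurable]: "cis \<in> borel_measurable borel"
  by (intro borel_measurable_continuous_onI continuous_intros)

lemma emeasure_circle_measure:
  assumes [measurable]: "S \<in> sets borel"
  shows "emeasure circle_measure S = emeasure lborel {\<theta> \<in> {0..<2*pi}. cis \<theta> \<in> S}"
proof -
  have "emeasure circle_measure S =
      emeasure (restrict_space lborel {0..<2*pi}) (cis -` S \<inter> space (restrict_space lborel {0..<2*pi}))"
    unfolding circle_measure_def
    by (subst emeasure_distr) (auto intro!: measurable_restrict_space1)
  also have "\<dots> = emeasure lborel (cis -` S \<inter> space (restrict_space lborel {0..<2*pi}))"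
    by (subst emeasure_restrict_space) (auto simp: space_restrict_space)
  also have "cis -` S \<inter> space (restrict_space lborel {0..<2*pi}) = {\<theta> \<in> {0..<2*pi}. cis \<theta> \<in> S}"
    by (auto simp: space_restrict_space)
  finally show ?thesis .
qed

lemma finite_measure_circle_measure: "finite_measure circle_measure"
proof
  have "emeasure circle_measure UNIV = emeasure lborel {0..<2*pi}"
    by (subst emeasure_circle_measure) (auto intro!: arg_cong[where f = "emeasure lborel"] simp del: emeasure_lborel_Ico)
  then show "emeasure circle_measure (space circle_measure) \<noteq> \<infinity>"
    by simp
qed

interpretation circle: finite_measure circle_measure
  by (rule finite_measure_circle_measure)

lemma AE_circle_measure_norm: "AE \<xi> in circle_measure. cmod \<xi> = 1"
proof (rule AE_I[where N = "{\<xi>. cmod \<xi> \<noteq> 1}"])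
  have [measurable]: "{\<xi>. cmod \<xi> \<noteq> 1} \<in> sets borel"
    by measurable
  show "emeasure circle_measure {\<xi>. cmod \<xi> \<noteq> 1} = 0"
    by (subst emeasure_circle_measure) auto
qed auto

lemma norm_cis_diff: "cmod (cis a - cis b) = 2 * \<bar>sin ((a - b) / 2)\<bar>"
proof -
  have "cis a - cis b = cis b * (cis (a - b) - 1)"
    by (simp add: algebra_simps cis_mult)
  then have "cmod (cis a - cis b) = cmod (cis (a - b) - 1)"
    by (simp add: norm_mult)
  then show ?thesis
    using dist_exp_i_1[of "a - b"] by (simp add: cis_conv_exp)
qed

text \<open>The Taylor bound leaves an error of at most \<open>u ^ 3 / 6\<close>, which is at most
  2u/3 on this range. The range reaches past pi/2, so every angle in [0, pi) or its supplement falls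
  into it.\<close>

lemma abs_le_3_sin:
  assumes "0 \<le> u" "u \<le> (2::real)"
  shows "u \<le> 3 * sin u"
proof -
  have "\<bar>sin u - (\<Sum>m<3. sin_coeff m * u ^ m)\<bar> \<le> inverse (fact 3) * \<bar>u\<bar> ^ 3"
    by (rule Maclaurin_sin_bound)
  then have "\<bar>sin u - u\<bar> \<le> u ^ 3 / 6"
    using assms by (simp add: sin_coeff_def eval_nat_numeral field_simps)
  moreover have "u ^ 3 \<le> 4 * u"
    using assms mult_mono[of u 2 u 2] mult_right_mono[of "u*u" 4 u]
    by (simp add: power3_eq_cube)
  ultimately show ?thesis by linarith
qed

text \<open>The centre need not lie on the circle. If the ball meets the circle at
  \<open>cis \<alpha>\<close>, all its angles are within 6r of \<open>\<alpha>\<close> modulo 2 pi.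
  The cut of the parameter interval at 0 therefore leads to three intervals of length 12r.\<close>

lemma emeasure_circle_ball_le:
  assumes "r > 0"
  shows "emeasure circle_measure (ball z r) \<le> ennreal (36 * r)"
proof (cases "{\<theta> \<in> {0..<2*pi}. cis \<theta> \<in> ball z r} = {}")
  case True
  then show ?thesis
    by (subst emeasure_circle_measure) (simp_all only: emeasure_empty zero_le borel_open open_ball)
next
  case False
  then obtain \<alpha> where \<alpha>: "0 \<le> \<alpha>" "\<alpha> < 2*pi" "dist z (cis \<alpha>) < r"
    by auto
  have sub: "{\<theta> \<in> {0..<2*pi}. cis \<theta> \<in> ball z r}
     \<subseteq> {\<alpha> - 6*r .. \<alpha> + 6*r} \<union> {\<alpha> - 2*pi - 6*r .. \<alpha> - 2*pi + 6*r}
         \<union> {\<alpha> + 2*pi - 6*r .. \<alpha> + 2*pi + 6*r}"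
  proof
    fix \<theta> assume "\<theta> \<in> {\<theta> \<in> {0..<2*pi}. cis \<theta> \<in> ball z r}"
    then have \<theta>: "0 \<le> \<theta>" "\<theta> < 2*pi" "dist z (cis \<theta>) < r" by auto
    define u where "u = \<bar>\<theta> - \<alpha>\<bar> / 2"
    have u: "0 \<le> u" "u < pi" using \<theta> \<alpha> by (auto simp: u_def abs_if)
    have "cmod (cis \<theta> - cis \<alpha>) < 2 * r"
      using \<theta>(3) \<alpha>(3) dist_triangle2[of "cis \<theta>" "cis \<alpha>" z]
      by (simp add: dist_norm dist_commute[of z] norm_minus_commute)
    moreover have "\<bar>sin ((\<theta> - \<alpha>) / 2)\<bar> = \<bar>sin u\<bar>"
    proof (cases "\<alpha> \<le> \<theta>")
      case False
      then have "u = - ((\<theta> - \<alpha>) / 2)" by (simp add: u_def field_simps)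
      then show ?thesis by (simp only: sin_minus abs_minus_cancel)
    qed (simp add: u_def)
    moreover have "\<bar>sin u\<bar> = sin u"
      using u by (simp add: sin_ge_zero)
    ultimately have s: "sin u < r" by (simp add: norm_cis_diff)
    show "\<theta> \<in> {\<alpha> - 6*r .. \<alpha> + 6*r} \<union> {\<alpha> - 2*pi - 6*r .. \<alpha> - 2*pi + 6*r}
         \<union> {\<alpha> + 2*pi - 6*r .. \<alpha> + 2*pi + 6*r}"
    proof (cases "u \<le> 2")
      case True
      then have "u \<le> 3 * sin u" using u abs_le_3_sin by blast
      then show ?thesis using s by (auto simp: u_def abs_if split: if_splits)
    next
      case False
      then have "pi - u \<le> 3 * sin (pi - u)" using u pi_less_4 by (intro abs_le_3_sin) auto
      then have "pi - u \<le> 3 * r" using s by simp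
      moreover have "\<theta> = \<alpha> + 2 * u \<or> \<theta> = \<alpha> - 2 * u"
        by (auto simp: u_def)
      ultimately show ?thesis using u by auto
    qed
  qed
  have "emeasure circle_measure (ball z r) \<le> emeasure lborel ({\<alpha> - 6*r .. \<alpha> + 6*r}
         \<union> {\<alpha> - 2*pi - 6*r .. \<alpha> - 2*pi + 6*r} \<union> {\<alpha> + 2*pi - 6*r .. \<alpha> + 2*pi + 6*r})"
    by (subst emeasure_circle_measure) (rule borel_open, simp, rule emeasure_mono[OF sub], simp)
  also have "\<dots> \<le> emeasure lborel {\<alpha> - 6*r .. \<alpha> + 6*r}
        + emeasure lborel {\<alpha> - 2*pi - 6*r .. \<alpha> - 2*pi + 6*r}
        + emeasure lborel {\<alpha> + 2*pi - 6*r .. \<alpha> + 2*pi + 6*r}"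
    by (intro order_trans[OF emeasure_subadditive] add_mono) auto
  also have "\<dots> = ennreal (36 * r)"
    using assms by (simp flip: ennreal_plus)
  finally show ?thesis .
qed

text \<open>A chord is no longer than its arc, so an arc of length \<open>r\<close> to one side of
  the centre fits. The side is chosen towards pi, where \<open>r \<le> 2 \<le> pi\<close> keeps the
  angles clear of the cut.\<close>

lemma emeasure_circle_ball_ge:
  assumes "cmod \<xi> = 1" "0 < r" "r \<le> 2"
  shows "ennreal r \<le> emeasure circle_measure (ball \<xi> r)"
proof -
  obtain \<alpha> where \<alpha>: "0 \<le> \<alpha>" "\<alpha> < 2*pi" "\<xi> = cis \<alpha>"
    using complex_norm_eq_1_exp[of \<xi>] assms(1) Arg2pi_ge_0 Arg2pi_lt_2pi
    by (metis cis_conv_exp)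
  have *: "cmod (cis \<alpha> - cis \<theta>) \<le> \<bar>\<alpha> - \<theta>\<bar>" for \<theta>
    using abs_sin_x_le_abs_x[of "(\<alpha> - \<theta>) / 2"] by (simp add: norm_cis_diff)
  have "\<exists>b. {b<..<b + r} \<subseteq> {\<theta> \<in> {0..<2*pi}. cis \<theta> \<in> ball \<xi> r}"
  proof (cases "\<alpha> \<le> pi")
    case True
    then have "{\<alpha><..<\<alpha> + r} \<subseteq> {\<theta> \<in> {0..<2*pi}. cis \<theta> \<in> ball \<xi> r}"
      using \<alpha> assms pi_ge_two * by (force simp: dist_norm intro: le_less_trans)
    then show ?thesis by blast
  next
    case False
    then have "{\<alpha> - r<..<\<alpha> - r + r} \<subseteq> {\<theta> \<in> {0..<2*pi}. cis \<theta> \<in> ball \<xi> r}"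
      using \<alpha> assms pi_ge_two * by (force simp: dist_norm intro: le_less_trans)
    then show ?thesis by blast
  qed
  then obtain b where b: "{b<..<b + r} \<subseteq> {\<theta> \<in> {0..<2*pi}. cis \<theta> \<in> ball \<xi> r}" ..
  have "ennreal r = emeasure lborel {b<..<b + r}"
    using assms by simp
  also have "\<dots> \<le> emeasure circle_measure (ball \<xi> r)"
    by (subst emeasure_circle_measure) (rule borel_open, simp, rule emeasure_mono[OF b], simp)
  finally show ?thesis .
qed

section \<open>A weak type maximal inequality\<close>

text \<open>
  A superlevel set of the maximal function of the indicator of \<open>E\<close>; the averages are
  normalised by the radius, not by the measure of the ball.
\<close>
definition max_set :: "complex set \<Rightarrow> real \<Rightarrow> complex set" where
  "max_set E s = {z. \<exists>r>0. ennreal (s * r) < emeasure circle_measure (E \<inter> ball z r)}"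

text \<open>The inequality at radius \<open>r\<close> is strict, so by continuity from below it
  survives for a slightly smaller concentric ball. That ball is contained in the balls of the
  original radius \<open>r\<close> about all nearby points.\<close>

lemma open_max_set:
  assumes [measurable]: "E \<in> sets borel"
  shows "open (max_set E s)"
  unfolding open_contains_ball
proof
  fix z assume "z \<in> max_set E s"
  then obtain r where r: "r > 0" "ennreal (s * r) < emeasure circle_measure (E \<inter> ball z r)"
    by (auto simp: max_set_def)
  define R where "R n = r - r / real (Suc n)" for n
  have inc: "incseq (\<lambda>n. E \<inter> ball z (R n))"
    using r(1) by (fastforce simp: incseq_def R_def frac_le intro: less_le_trans)
  have un: "(\<Union>n. E \<inter> ball z (R n)) = E \<inter> ball z r"
  proof (intro equalityI subsetI)
    fix w assume w: "w \<in> E \<inter> ball z r"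
    have "R \<longlonglongrightarrow> r - 0"
      unfolding R_def by (intro tendsto_intros LIMSEQ_Suc lim_const_over_n)
    then have "\<forall>\<^sub>F n in sequentially. dist z w < R n"
      using w by (intro order_tendstoD(1)) auto
    then obtain n where "dist z w < R n"
      by (auto simp: eventually_sequentially)
    then show "w \<in> (\<Union>n. E \<inter> ball z (R n))" using w by auto
  next
    fix w assume "w \<in> (\<Union>n. E \<inter> ball z (R n))"
    then obtain n where "w \<in> E" "dist z w < R n" by auto
    moreover have "R n \<le> r" using r(1) by (simp add: R_def)
    ultimately show "w \<in> E \<inter> ball z r" by auto
  qed
  have "(\<lambda>n. emeasure circle_measure (E \<inter> ball z (R n))) \<longlonglongrightarrow> emeasure circle_measure (E \<inter> ball z r)"
    using Lim_emeasure_incseq[of "\<lambda>n. E \<inter> ball z (R n)" circle_measure] inc un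
    by (simp add: image_subset_iff)
  then have "\<forall>\<^sub>F n in sequentially. ennreal (s * r) < emeasure circle_measure (E \<inter> ball z (R n))"
    using r(2) by (rule order_tendstoD(1))
  then obtain n where n: "ennreal (s * r) < emeasure circle_measure (E \<inter> ball z (R n))"
    by (auto simp: eventually_sequentially)
  have "ball z (r / real (Suc n)) \<subseteq> max_set E s"
  proof
    fix w assume "w \<in> ball z (r / real (Suc n))"
    then have w: "dist z w < r / real (Suc n)" by simp
    have "ball z (R n) \<subseteq> ball w r"
    proof
      fix v assume "v \<in> ball z (R n)"
      then show "v \<in> ball w r"
        using w dist_triangle[of w v z] by (simp add: R_def dist_commute)
    qed
    then have "emeasure circle_measure (E \<inter> ball z (R n)) \<le> emeasure circle_measure (E \<inter> ball w r)"
      by (intro emeasure_mono) auto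
    then show "w \<in> max_set E s"
      using n r(1) by (auto simp: max_set_def intro: less_le_trans)
  qed
  then show "\<exists>e>0. ball z e \<subseteq> max_set E s"
    using r(1) by (intro exI[of _ "r / real (Suc n)"]) auto
qed

lemma max_set_sets [measurable]: "E \<in> sets borel \<Longrightarrow> max_set E s \<in> sets borel"
  by (rule borel_open[OF open_max_set])

text \<open>The Vitali covering lemma delivers a countable set of centres rather than a sequence, so
  sums over it are written as integrals over \<open>count_space\<close>.\<close>

lemma emeasure_UN_countable_subadditive:
  assumes "countable I" and [measurable]: "\<And>i. i \<in> I \<Longrightarrow> A i \<in> sets M"
  shows "emeasure M (\<Union>i\<in>I. A i) \<le> (\<integral>\<^sup>+i. emeasure M (A i) \<partial>count_space I)"
proof -
  have "emeasure M (\<Union>i\<in>I. A i) = (\<integral>\<^sup>+x. indicator (\<Union>i\<in>I. A i) x \<partial>M)"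
    using assms by (intro nn_integral_indicator[symmetric] sets.countable_UN') auto
  also have "\<dots> \<le> (\<integral>\<^sup>+x. (\<integral>\<^sup>+i. indicator (A i) x \<partial>count_space I) \<partial>M)"
  proof (rule nn_integral_mono)
    fix x
    show "(indicator (\<Union>i\<in>I. A i) x :: ennreal) \<le> (\<integral>\<^sup>+i. indicator (A i) x \<partial>count_space I)"
    proof (cases "x \<in> (\<Union>i\<in>I. A i)")
      case True
      then obtain i where "i \<in> I" "x \<in> A i" by auto
      then show ?thesis
        using nn_integral_ge_point[of i I "\<lambda>i. indicator (A i) x"] by (simp add: indicator_def)
    qed simp
  qed
  also have "\<dots> = (\<integral>\<^sup>+i. (\<integral>\<^sup>+x. indicator (A i) x \<partial>M) \<partial>count_space I)"
    using assms by (intro nn_integral_count_space_nn_integral) auto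
  also have "\<dots> = (\<integral>\<^sup>+i. emeasure M (A i) \<partial>count_space I)"
    using assms by (intro nn_integral_cong) auto
  finally show ?thesis .
qed

text \<open>Vitali covering: disjoint balls are selected whose fivefold enlargements cover, and 180
  = 36 * 5 with 36 from \<open>emeasure_circle_ball_le\<close>. The radii are bounded, as the
  covering lemma requires, because the circle has finite length and averages are normalised by the
  radius.\<close>

lemma emeasure_max_set_le:
  assumes [measurable]: "E \<in> sets borel" and s: "s > 0"
  shows "emeasure circle_measure (max_set E s) \<le> ennreal (180 / s) * emeasure circle_measure E"
proof -
  define K where "K = max_set E s"
  have "\<forall>z\<in>K. \<exists>r>0. ennreal (s * r) < emeasure circle_measure (E \<inter> ball z r)"
    by (auto simp: K_def max_set_def)
  then obtain r where r: "\<And>z. z \<in> K \<Longrightarrow> r z > 0"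
      "\<And>z. z \<in> K \<Longrightarrow> ennreal (s * r z) < emeasure circle_measure (E \<inter> ball z (r z))"
    by metis
  define B where "B = measure circle_measure UNIV / s"
  have rB: "0 < r z \<and> r z \<le> B" if "z \<in> K" for z
  proof -
    have "ennreal (s * r z) < emeasure circle_measure UNIV"
      by (rule less_le_trans[OF r(2)[OF that]]) (auto intro!: emeasure_mono)
    then have "ennreal (s * r z) < ennreal (measure circle_measure UNIV)"
      by (simp add: circle.emeasure_eq_measure)
    then have "s * r z \<le> measure circle_measure UNIV"
      using ennreal_less_iff s r(1)[OF that] by (metis less_eq_real_def mult_nonneg_nonneg)
    then show ?thesis using r(1)[OF that] s by (simp add: B_def field_simps)
  qed
  obtain C where C: "countable C" "C \<subseteq> K"
     "pairwise (\<lambda>i j. disjnt (ball i (r i)) (ball j (r j))) C"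
     "K \<subseteq> (\<Union>i\<in>C. ball i (5 * r i))"
    by (rule Vitali_covering_lemma_balls[where S = K and K = K and a = "\<lambda>z. z" and r = r and B = B])
       (use rB in auto)
  have dj: "disjoint_family_on (\<lambda>i. E \<inter> ball i (r i)) C"
    using C(3) by (auto simp: disjoint_family_on_def pairwise_def disjnt_def)
  have "emeasure circle_measure K \<le> emeasure circle_measure (\<Union>i\<in>C. ball i (5 * r i))"
    using C by (intro emeasure_mono) auto
  also have "\<dots> \<le> (\<integral>\<^sup>+i. emeasure circle_measure (ball i (5 * r i)) \<partial>count_space C)"
    using C(1) by (intro emeasure_UN_countable_subadditive) auto
  also have "\<dots> \<le> (\<integral>\<^sup>+i. ennreal (180 / s) * emeasure circle_measure (E \<inter> ball i (r i)) \<partial>count_space C)"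
  proof (rule nn_integral_mono)
    fix i assume "i \<in> space (count_space C)"
    then have i: "i \<in> K" using C by auto
    have "emeasure circle_measure (ball i (5 * r i)) \<le> ennreal (36 * (5 * r i))"
      using r(1)[OF i] by (intro emeasure_circle_ball_le) auto
    also have "\<dots> = ennreal (180 / s) * ennreal (s * r i)"
      using s r(1)[OF i] by (subst ennreal_mult'[symmetric]) auto
    also have "\<dots> \<le> ennreal (180 / s) * emeasure circle_measure (E \<inter> ball i (r i))"
      using r(2)[OF i] by (intro mult_left_mono) auto
    finally show "emeasure circle_measure (ball i (5 * r i)) \<le>
         ennreal (180 / s) * emeasure circle_measure (E \<inter> ball i (r i))" .
  qed
  also have "\<dots> = ennreal (180 / s) * (\<integral>\<^sup>+i. emeasure circle_measure (E \<inter> ball i (r i)) \<partial>count_space C)"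
    by (rule nn_integral_cmult) simp
  also have "(\<integral>\<^sup>+i. emeasure circle_measure (E \<inter> ball i (r i)) \<partial>count_space C)
      = emeasure circle_measure (\<Union>i\<in>C. E \<inter> ball i (r i))"
    using C(1) dj by (intro emeasure_UN_countable[symmetric]) auto
  also have "ennreal (180 / s) * emeasure circle_measure (\<Union>i\<in>C. E \<inter> ball i (r i))
      \<le> ennreal (180 / s) * emeasure circle_measure E"
    by (intro mult_left_mono emeasure_mono) auto
  finally show ?thesis by (simp add: K_def)
qed

section \<open>Weak Lebesgue spaces\<close>

definition weak_bounded :: "real \<Rightarrow> real \<Rightarrow> (complex \<Rightarrow> ennreal) \<Rightarrow> bool" where
  "weak_bounded q N g \<longleftrightarrow> (\<forall>s>0. s * measure circle_measure {\<xi>. ennreal s < g \<xi>} powr (1/q) \<le> N)"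

lemma weak_Lq_norm_le_iff:
  "N \<ge> 0 \<Longrightarrow> weak_Lq_norm q g \<le> ennreal N \<longleftrightarrow> weak_bounded q N g"
  by (auto simp: weak_Lq_norm_def weak_bounded_def SUP_le_iff)

lemma weak_Lq_norm_finite_iff:
  "weak_Lq_norm q g < \<infinity> \<longleftrightarrow> (\<exists>N>0. weak_bounded q N g)"
proof
  assume fin: "weak_Lq_norm q g < \<infinity>"
  define N where "N = enn2real (weak_Lq_norm q g) + 1"
  have "weak_Lq_norm q g \<le> ennreal N"
    using fin unfolding N_def by (cases "weak_Lq_norm q g") (auto intro!: ennreal_leI)
  moreover have "N > 0" by (simp add: N_def add_nonneg_pos)
  ultimately show "\<exists>N>0. weak_bounded q N g"
    using weak_Lq_norm_le_iff[of N q g] by auto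
next
  assume "\<exists>N>0. weak_bounded q N g"
  then obtain N where "N > 0" "weak_bounded q N g" by blast
  then have "weak_Lq_norm q g \<le> ennreal N" by (simp add: weak_Lq_norm_le_iff)
  then show "weak_Lq_norm q g < \<infinity>" by (auto intro: le_less_trans)
qed

text \<open>Domination is required only on the unit circle, which carries
  \<open>circle_measure\<close>: the geometric description of the cones used for the comparisons is
  valid only there.\<close>

lemma weak_bounded_mono_scaled:
  assumes f: "weak_bounded q N f" and [measurable]: "f \<in> borel_measurable borel" "g \<in> borel_measurable borel"
    and c: "c > 0" and q: "q > 0"
    and le: "\<And>\<xi>. cmod \<xi> = 1 \<Longrightarrow> g \<xi> \<le> ennreal c * f \<xi>"
  shows "weak_bounded q (c * N) g"
  unfolding weak_bounded_def
proof (intro allI impI)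
  fix s :: real assume s: "s > 0"
  have "measure circle_measure {\<xi>. ennreal s < g \<xi>} \<le> measure circle_measure {\<xi>. ennreal (s / c) < f \<xi>}"
  proof (rule circle.finite_measure_mono_AE)
    show "AE \<xi> in circle_measure. \<xi> \<in> {\<xi>. ennreal s < g \<xi>} \<longrightarrow> \<xi> \<in> {\<xi>. ennreal (s / c) < f \<xi>}"
      using AE_circle_measure_norm
    proof eventually_elim
      fix \<xi> assume \<xi>: "cmod \<xi> = 1"
      show "\<xi> \<in> {\<xi>. ennreal s < g \<xi>} \<longrightarrow> \<xi> \<in> {\<xi>. ennreal (s / c) < f \<xi>}"
      proof (rule impI, rule ccontr)
        assume a: "\<xi> \<in> {\<xi>. ennreal s < g \<xi>}" and "\<xi> \<notin> {\<xi>. ennreal (s / c) < f \<xi>}"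
        then have "f \<xi> \<le> ennreal (s / c)" by simp
        then have "ennreal c * f \<xi> \<le> ennreal c * ennreal (s / c)" by (rule mult_left_mono) simp
        also have "\<dots> = ennreal s" using c s by (simp flip: ennreal_mult')
        finally show False using le[OF \<xi>] a by auto
      qed
    qed
  qed measurable
  then have "measure circle_measure {\<xi>. ennreal s < g \<xi>} powr (1/q)
      \<le> measure circle_measure {\<xi>. ennreal (s / c) < f \<xi>} powr (1/q)"
    using q by (intro powr_mono2) auto
  moreover have "s / c * measure circle_measure {\<xi>. ennreal (s / c) < f \<xi>} powr (1/q) \<le> N"
    using f c s divide_pos_pos[of s c] unfolding weak_bounded_def by blast
  ultimately have "s / c * measure circle_measure {\<xi>. ennreal s < g \<xi>} powr (1/q) \<le> N"
    using c s by (meson divide_pos_pos less_imp_le mult_left_mono order_trans)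
  then show "s * measure circle_measure {\<xi>. ennreal s < g \<xi>} powr (1/q) \<le> c * N"
    using c by (simp add: field_simps)
qed

text \<open>One factor 2 comes from halving the level \<open>s\<close>, the other bounds
  \<open>2 powr (1/q)\<close>, the price of a union of two sets.\<close>

lemma weak_bounded_add:
  assumes f: "weak_bounded q N f" and g: "weak_bounded q M g"
    and [measurable]: "f \<in> borel_measurable borel" "g \<in> borel_measurable borel"
    and q: "q > 1"
  shows "weak_bounded q (4 * (N + M)) (\<lambda>\<xi>. f \<xi> + g \<xi>)"
  unfolding weak_bounded_def
proof (intro allI impI)
  fix s :: real assume s: "s > 0"
  define a where "a = measure circle_measure {\<xi>. ennreal (s/2) < f \<xi>}"
  define b where "b = measure circle_measure {\<xi>. ennreal (s/2) < g \<xi>}"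
  have "measure circle_measure {\<xi>. ennreal s < f \<xi> + g \<xi>}
      \<le> measure circle_measure ({\<xi>. ennreal (s/2) < f \<xi>} \<union> {\<xi>. ennreal (s/2) < g \<xi>})"
  proof (rule circle.finite_measure_mono)
    show "{\<xi>. ennreal s < f \<xi> + g \<xi>} \<subseteq> {\<xi>. ennreal (s/2) < f \<xi>} \<union> {\<xi>. ennreal (s/2) < g \<xi>}"
    proof (rule ccontr)
      assume "\<not> ?thesis"
      then obtain \<xi> where \<xi>: "ennreal s < f \<xi> + g \<xi>" "f \<xi> \<le> ennreal (s/2)" "g \<xi> \<le> ennreal (s/2)"
        by (auto simp: subset_iff simp flip: not_less)
      then have "f \<xi> + g \<xi> \<le> ennreal (s/2) + ennreal (s/2)" by (intro add_mono)
      also have "\<dots> = ennreal s" using s by (simp flip: ennreal_plus)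
      finally show False using \<xi> by simp
    qed
  qed measurable
  also have "\<dots> \<le> a + b"
    unfolding a_def b_def by (intro measure_Un_le) (simp_all, measurable)
  finally have le: "measure circle_measure {\<xi>. ennreal s < f \<xi> + g \<xi>} \<le> a + b" .
  have ab: "a \<ge> 0" "b \<ge> 0" by (auto simp: a_def b_def)
  have "measure circle_measure {\<xi>. ennreal s < f \<xi> + g \<xi>} powr (1/q) \<le> (a + b) powr (1/q)"
    using le q by (intro powr_mono2) auto
  also have "\<dots> \<le> (2 * max a b) powr (1/q)"
    using ab q by (intro powr_mono2) auto
  also have "\<dots> = 2 powr (1/q) * max a b powr (1/q)"
    by (rule powr_mult)
  also have "\<dots> \<le> 2 * max a b powr (1/q)"
    using q powr_mono[of "1/q" 1 2] by (intro mult_right_mono) auto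
  also have "max a b powr (1/q) \<le> a powr (1/q) + b powr (1/q)"
    by (simp add: max_def)
  finally have "s * measure circle_measure {\<xi>. ennreal s < f \<xi> + g \<xi>} powr (1/q)
      \<le> s * (2 * (a powr (1/q) + b powr (1/q)))"
    using s by simp
  moreover have "s/2 * a powr (1/q) \<le> N" "s/2 * b powr (1/q) \<le> M"
    using f g s by (auto simp: weak_bounded_def a_def b_def simp del: times_divide_eq_left)
  ultimately show "s * measure circle_measure {\<xi>. ennreal s < f \<xi> + g \<xi>} powr (1/q) \<le> 4 * (N + M)"
    by (simp add: algebra_simps)
qed

lemma weak_bounded_imp_measure_top_eq_0:
  assumes f: "weak_bounded q N f" and [measurable]: "f \<in> borel_measurable borel" and q: "q > 0"
  shows "measure circle_measure {\<xi>. f \<xi> = \<infinity>} = 0"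
proof (rule ccontr)
  assume "measure circle_measure {\<xi>. f \<xi> = \<infinity>} \<noteq> 0"
  then have pos: "measure circle_measure {\<xi>. f \<xi> = \<infinity>} > 0" by (simp add: zero_less_measure_iff)
  define a where "a = measure circle_measure {\<xi>. f \<xi> = \<infinity>} powr (1/q)"
  have a: "a > 0" using pos by (simp add: a_def)
  define s where "s = (\<bar>N\<bar> + 1) / a"
  have s: "s > 0" using a by (simp add: s_def)
  have "measure circle_measure {\<xi>. f \<xi> = \<infinity>} \<le> measure circle_measure {\<xi>. ennreal s < f \<xi>}"
    by (rule circle.finite_measure_mono) auto
  then have "a \<le> measure circle_measure {\<xi>. ennreal s < f \<xi>} powr (1/q)"
    unfolding a_def using q by (intro powr_mono2) auto
  then have "s * a \<le> s * measure circle_measure {\<xi>. ennreal s < f \<xi>} powr (1/q)"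
    using s by simp
  also have "\<dots> \<le> N" using f s by (simp add: weak_bounded_def)
  finally show False using a by (simp add: s_def)
qed

text \<open>A dyadic layer-cake bound. For finite \<open>y > s\<close> the last summand that is
  switched on already reaches \<open>y\<close>; for infinite \<open>y\<close> the sum diverges. The
  contradiction handles both cases: a sum below \<open>y\<close> forces one threshold after another
  below \<open>y\<close>, so the summands are unbounded.\<close>

lemma ennreal_le_dyadic_sum:
  fixes y :: ennreal
  assumes s: "s > 0"
  shows "y \<le> ennreal s + (\<Sum>k. ennreal (2 ^ Suc k * s) * indicator {y. ennreal (2 ^ k * s) < y} y)"
    (is "_ \<le> _ + ?S")
proof (rule ccontr)
  assume "\<not> ?thesis"
  then have less: "ennreal s + ?S < y" by simp
  have S: "?S < y" by (rule le_less_trans[OF _ less]) simp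
  have summand: "ennreal (2 ^ Suc n * s) \<le> ?S" if "ennreal (2 ^ n * s) < y" for n
  proof -
    have "(\<Sum>k\<in>{n}. ennreal (2 ^ Suc k * s) * indicator {y. ennreal (2 ^ k * s) < y} y) \<le> ?S"
      by (rule sum_le_suminf) auto
    then show ?thesis using that by simp
  qed
  have all: "ennreal (2 ^ n * s) < y" for n
  proof (induction n)
    case 0
    have "ennreal s < y" by (rule le_less_trans[OF _ less]) simp
    then show ?case by simp
  next
    case (Suc n)
    then show ?case using summand[OF Suc] S by (auto intro: le_less_trans)
  qed
  have "?S < \<infinity>" using S by (auto intro: less_le_trans)
  then obtain r where r: "r \<ge> 0" "?S = ennreal r"
    by (cases ?S) auto
  have "2 ^ Suc n * s \<le> r" for n
    using summand[OF all[of n]] r by simp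
  moreover obtain n where "r / s < 2 ^ n" using real_arch_pow[of 2 "r/s"] by auto
  then have "r < 2 ^ n * s" using s by (simp add: field_simps)
  moreover have "2 ^ n * s \<le> 2 ^ Suc n * s" using s by simp
  ultimately show False by (meson not_less order_trans)
qed

text \<open>The 1 is the contribution of the values below the splitting level; the fraction is the
  dyadic tail above it, a geometric series of ratio \<open>2 powr (1 - q)\<close>.\<close>

definition kolmogorov_const :: "real \<Rightarrow> real" where
  "kolmogorov_const q = 1 + 2 / (1 - 2 powr (1 - q))"

lemma kolmogorov_const_pos: "q > 1 \<Longrightarrow> kolmogorov_const q > 0"
proof -
  assume "q > 1"
  then have "2 powr (1 - q) < 2 powr (0::real)" by (intro powr_less_mono) auto
  then show ?thesis by (auto simp: kolmogorov_const_def intro!: add_pos_pos)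
qed

text \<open>Kolmogorov's inequality. Values up to a level \<open>s\<close> contribute at most
  \<open>s\<close> times the measure of \<open>F\<close>. Above it, the weak bound makes the dyadic
  layers decay like \<open>2 powr (k * (1 - q))\<close>, which is summable as
  \<open>q > 1\<close>.\<close>

lemma weak_bounded_set_integral_le:
  assumes f: "weak_bounded q N f" and [measurable]: "f \<in> borel_measurable borel" "F \<in> sets borel"
    and q: "q > 1" and N: "N > 0"
  shows "(\<integral>\<^sup>+\<xi>\<in>F. f \<xi> \<partial>circle_measure)
     \<le> ennreal (kolmogorov_const q * N * measure circle_measure F powr (1 - 1/q))"
proof (cases "measure circle_measure F = 0")
  case True
  then have "AE \<xi> in circle_measure. f \<xi> * indicator F \<xi> = 0"
    by (intro AE_I[of _ _ F]) (auto simp: circle.emeasure_eq_measure indicator_def)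
  then have "(\<integral>\<^sup>+\<xi>\<in>F. f \<xi> \<partial>circle_measure) = (\<integral>\<^sup>+\<xi>. 0 \<partial>circle_measure)"
    by (rule nn_integral_cong_AE)
  then show ?thesis by simp
next
  case False
  define a where "a = measure circle_measure F"
  have a: "a > 0" using False by (simp add: a_def zero_less_measure_iff)
  \<comment> \<open>At this level the weak bound \<open>(N / s) powr q\<close> on the superlevel set
    equals \<open>a\<close>, so the parts below and above \<open>s\<close> are of the same
    order.\<close>
  define s where "s = N * a powr (- 1/q)"
  have s: "s > 0" using N a by (simp add: s_def)
  define G where "G k = {\<xi>. ennreal (2 ^ k * s) < f \<xi>}" for k :: nat
  have [measurable]: "G k \<in> sets borel" for k unfolding G_def by measurable
  define v where "v = 2 powr (1 - q)"
  have v: "0 < v" "v < 1"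
    using q powr_less_mono[of "1 - q" 0 "2::real"] by (auto simp: v_def)
  have sa: "s * a = N * a powr (1 - 1/q)"
    using a by (simp add: s_def powr_diff powr_minus field_simps)
  have sq: "s * (N / s) powr q = N * a powr (1 - 1/q)"
  proof -
    have "N / s = a powr (1/q)" using N a by (simp add: s_def powr_minus field_simps)
    then have "(N / s) powr q = a" using a q by (simp add: powr_powr)
    then show ?thesis using sa by simp
  qed
  have summand: "ennreal (2 ^ Suc k * s) * emeasure circle_measure (G k) \<le> ennreal (2 * (N * a powr (1 - 1/q)) * v ^ k)"
    for k
  proof -
    define b where "b = measure circle_measure (G k)"
    have "2 ^ k * s * b powr (1/q) \<le> N"
      using f s by (simp add: weak_bounded_def b_def G_def)
    then have "b powr (1/q) \<le> N / (2 ^ k * s)" using s by (simp add: field_simps)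
    then have "(b powr (1/q)) powr q \<le> (N / (2 ^ k * s)) powr q"
      using q by (intro powr_mono2) auto
    then have "b \<le> (N / (2 ^ k * s)) powr q"
      using q by (simp add: powr_powr b_def)
    also have "\<dots> = (N / s) powr q / (2 ^ k) powr q"
      using N s by (subst powr_divide[symmetric]) (auto simp: field_simps)
    finally have b: "b \<le> (N / s) powr q / (2 ^ k) powr q" .
    have vk: "v ^ k = 2 ^ k / (2 ^ k) powr q"
      by (simp add: v_def powr_diff power_divide powr_power powr_powr mult.commute flip: powr_realpow)
    have "2 ^ Suc k * s * b \<le> 2 ^ Suc k * s * ((N / s) powr q / (2 ^ k) powr q)"
      using b s by (intro mult_left_mono) auto
    also have "\<dots> = 2 * (s * (N / s) powr q) * (2 ^ k / (2 ^ k) powr q)"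
      by simp
    also have "\<dots> = 2 * (N * a powr (1 - 1/q)) * v ^ k"
      unfolding sq vk ..
    finally have "ennreal (2 ^ Suc k * s * b) \<le> ennreal (2 * (N * a powr (1 - 1/q)) * v ^ k)"
      by (rule ennreal_leI)
    then show ?thesis
      using s by (simp add: circle.emeasure_eq_measure b_def ennreal_mult')
  qed
  have "(\<integral>\<^sup>+\<xi>\<in>F. f \<xi> \<partial>circle_measure) \<le>
     (\<integral>\<^sup>+\<xi>. ennreal s * indicator F \<xi> + (\<Sum>k. ennreal (2 ^ Suc k * s) * indicator (G k) \<xi>) \<partial>circle_measure)"
  proof (rule nn_integral_mono)
    fix \<xi>
    have "f \<xi> \<le> ennreal s + (\<Sum>k. ennreal (2 ^ Suc k * s) * indicator (G k) \<xi>)"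
      using ennreal_le_dyadic_sum[OF s, of "f \<xi>"] by (simp add: G_def indicator_def)
    then show "f \<xi> * indicator F \<xi> \<le> ennreal s * indicator F \<xi> + (\<Sum>k. ennreal (2 ^ Suc k * s) * indicator (G k) \<xi>)"
      by (cases "\<xi> \<in> F") auto
  qed
  also have "\<dots> = (\<integral>\<^sup>+\<xi>. ennreal s * indicator F \<xi> \<partial>circle_measure)
      + (\<integral>\<^sup>+\<xi>. (\<Sum>k. ennreal (2 ^ Suc k * s) * indicator (G k) \<xi>) \<partial>circle_measure)"
    by (rule nn_integral_add) measurable
  also have "(\<integral>\<^sup>+\<xi>. (\<Sum>k. ennreal (2 ^ Suc k * s) * indicator (G k) \<xi>) \<partial>circle_measure)
      = (\<Sum>k. ennreal (2 ^ Suc k * s) * emeasure circle_measure (G k))"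
    by (subst nn_integral_suminf) (auto simp: nn_integral_cmult_indicator)
  also have "\<dots> \<le> (\<Sum>k. ennreal (2 * (N * a powr (1 - 1/q)) * v ^ k))"
    by (intro suminf_le summand) auto
  also have "\<dots> = ennreal (2 * (N * a powr (1 - 1/q)) * (1 / (1 - v)))"
    using v N by (intro suminf_ennreal_eq sums_mult geometric_sums) auto
  also have "(\<integral>\<^sup>+\<xi>. ennreal s * indicator F \<xi> \<partial>circle_measure) = ennreal (s * a)"
    using s by (simp add: nn_integral_cmult_indicator circle.emeasure_eq_measure a_def ennreal_mult')
  also have "ennreal (s * a) + ennreal (2 * (N * a powr (1 - 1/q)) * (1 / (1 - v)))
      = ennreal (kolmogorov_const q * N * a powr (1 - 1/q))"
    unfolding sa using v N
    by (subst ennreal_plus[symmetric]) (auto simp: kolmogorov_const_def v_def algebra_simps)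
  finally show ?thesis by (simp add: a_def add_left_mono)
qed

text \<open>The converse of Kolmogorov's inequality: test with the superlevel set \<open>E\<close>
  itself, where the integral is at least \<open>s\<close> times its measure, and divide by the
  measure to the power 1 - 1/q, which is finite because the circle is.\<close>

lemma weak_boundedI_set_integral:
  assumes [measurable]: "f \<in> borel_measurable borel" and q: "q > 0" and K: "K \<ge> 0"
    and le: "\<And>E. E \<in> sets borel \<Longrightarrow>
       (\<integral>\<^sup>+\<xi>\<in>E. f \<xi> \<partial>circle_measure) \<le> ennreal (K * measure circle_measure E powr (1 - 1/q))"
  shows "weak_bounded q K f"
  unfolding weak_bounded_def
proof (intro allI impI)
  fix s :: real assume s: "s > 0"
  define E where "E = {\<xi>. ennreal s < f \<xi>}"
  have [measurable]: "E \<in> sets borel" unfolding E_def by measurable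
  define a where "a = measure circle_measure E"
  show "s * measure circle_measure {\<xi>. ennreal s < f \<xi>} powr (1/q) \<le> K"
  proof (cases "a = 0")
    case True
    then show ?thesis using K by (simp flip: E_def a_def)
  next
    case False
    then have a: "a > 0" by (simp add: a_def zero_less_measure_iff)
    have "ennreal (s * a) = (\<integral>\<^sup>+\<xi>. ennreal s * indicator E \<xi> \<partial>circle_measure)"
      using s by (simp add: nn_integral_cmult_indicator circle.emeasure_eq_measure a_def ennreal_mult')
    also have "\<dots> \<le> (\<integral>\<^sup>+\<xi>\<in>E. f \<xi> \<partial>circle_measure)"
      by (intro nn_integral_mono) (auto simp: E_def indicator_def)
    also have "\<dots> \<le> ennreal (K * a powr (1 - 1/q))"
      unfolding a_def by (rule le) measurable
    finally have "s * a \<le> K * a powr (1 - 1/q)"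
      using K by (subst (asm) ennreal_le_iff) auto
    moreover have "a = a powr (1/q) * a powr (1 - 1/q)"
      using a by (simp flip: powr_add)
    ultimately have "(s * a powr (1/q)) * a powr (1 - 1/q) \<le> K * a powr (1 - 1/q)"
      by (simp add: mult.assoc)
    then show ?thesis using a by (simp flip: E_def a_def)
  qed
qed

section \<open>Change of aperture\<close>

text \<open>
  By Fatou's lemma the integral is lower semicontinuous in \<open>\<xi>\<close>, so no \<open>\<sigma>\<close>-finiteness is needed.
  This matters because \<open>weak_Lq_norm\<close> uses \<open>measure\<close>, which is \<open>0\<close> on nonmeasurable sets.
\<close>
lemma borel_measurable_nn_integral_open_section:
  fixes Q :: "'a::metric_space \<Rightarrow> 'b \<Rightarrow> bool"
  assumes op: "\<And>z. z \<in> space M \<Longrightarrow> open {\<xi>. Q \<xi> z}"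
    and [measurable]: "\<And>\<xi>. (\<lambda>z. h z * indicator {z. Q \<xi> z} z) \<in> borel_measurable M"
  shows "(\<lambda>\<xi>. \<integral>\<^sup>+z. h z * indicator {z. Q \<xi> z} z \<partial>M) \<in> borel_measurable borel"
proof (rule borel_measurableI_le)
  fix c :: ennreal
  have "closed {\<xi>. (\<integral>\<^sup>+z. h z * indicator {z. Q \<xi> z} z \<partial>M) \<le> c}"
    unfolding closed_sequential_limits
  proof (intro allI impI, elim conjE)
    fix X l assume X: "\<forall>n. X n \<in> {\<xi>. (\<integral>\<^sup>+z. h z * indicator {z. Q \<xi> z} z \<partial>M) \<le> c}" and lim: "X \<longlonglongrightarrow> l"
    have "(\<integral>\<^sup>+z. h z * indicator {z. Q l z} z \<partial>M)
        \<le> (\<integral>\<^sup>+z. liminf (\<lambda>n. h z * indicator {z. Q (X n) z} z) \<partial>M)"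
    proof (rule nn_integral_mono)
      fix z assume z: "z \<in> space M"
      show "h z * indicator {z. Q l z} z \<le> liminf (\<lambda>n. h z * indicator {z. Q (X n) z} z)"
      proof (cases "Q l z")
        case True
        have "\<forall>\<^sub>F n in sequentially. X n \<in> {\<xi>. Q \<xi> z}"
          using lim op[OF z] True by (intro topological_tendstoD) auto
        then have "\<forall>\<^sub>F n in sequentially. h z * indicator {z. Q l z} z \<le> h z * indicator {z. Q (X n) z} z"
          by eventually_elim (use True in simp)
        then show ?thesis by (rule Liminf_bounded)
      qed simp
    qed
    also have "\<dots> \<le> liminf (\<lambda>n. \<integral>\<^sup>+z. h z * indicator {z. Q (X n) z} z \<partial>M)"
      by (rule nn_integral_liminf) measurable
    also have "\<dots> \<le> c"
      using X by (intro Liminf_le always_eventually) auto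
    finally show "l \<in> {\<xi>. (\<integral>\<^sup>+z. h z * indicator {z. Q \<xi> z} z \<partial>M) \<le> c}" by simp
  qed
  then show "{\<xi> \<in> space borel. (\<integral>\<^sup>+z. h z * indicator {z. Q \<xi> z} z \<partial>M) \<le> c} \<in> sets borel"
    by simp
qed

section \<open>Cones and their shadows on the circle\<close>

lemma open_lusin_cone: "open (lusin_cone \<sigma> \<xi>)"
proof -
  have "open ({z. cmod z < 1} \<inter> {z. cmod (1 - cnj \<xi> * z) < \<sigma> * (1 - cmod z)})"
    by (intro open_Int open_Collect_less continuous_intros)
  also have "{z. cmod z < 1} \<inter> {z. cmod (1 - cnj \<xi> * z) < \<sigma> * (1 - cmod z)} = lusin_cone \<sigma> \<xi>"
    by (auto simp: lusin_cone_def unit_disk_def)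
  finally show ?thesis .
qed

text \<open>\<open>\<xi>\<close> ranges over the whole plane, which makes shadows open there; only
  their trace on the unit circle carries measure.\<close>

definition shadow :: "real \<Rightarrow> complex \<Rightarrow> complex set" where
  "shadow \<sigma> z = {\<xi>. z \<in> lusin_cone \<sigma> \<xi>}"

lemma open_shadow: "open (shadow \<sigma> z)"
proof (cases "cmod z < 1")
  case True
  then have "shadow \<sigma> z = {\<xi>. cmod (1 - cnj \<xi> * z) < \<sigma> * (1 - cmod z)}"
    by (auto simp: shadow_def lusin_cone_def unit_disk_def)
  then show ?thesis by (auto intro!: open_Collect_less continuous_intros)
next
  case False
  then have "shadow \<sigma> z = {}" by (auto simp: shadow_def lusin_cone_def unit_disk_def)
  then show ?thesis by simp
qed

lemma shadow_sets [measurable]: "shadow \<sigma> z \<in> sets borel"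
  by (rule borel_open[OF open_shadow])

lemma norm_one_minus_cnj_mult:
  assumes "cmod \<xi> = 1"
  shows "cmod (1 - cnj \<xi> * z) = cmod (\<xi> - z)"
proof -
  have "\<xi> * cnj \<xi> = 1"
    using assms complex_norm_square[of \<xi>] by simp
  then have "\<xi> - z = \<xi> * (1 - cnj \<xi> * z)"
    by (metis mult.assoc mult.left_neutral mult.right_neutral right_diff_distrib)
  then show ?thesis using assms by (metis mult_1 norm_mult)
qed

lemma mem_lusin_cone_iff:
  assumes "cmod \<xi> = 1"
  shows "z \<in> lusin_cone \<sigma> \<xi> \<longleftrightarrow> cmod z < 1 \<and> cmod (\<xi> - z) < \<sigma> * (1 - cmod z)"
  using assms by (auto simp: lusin_cone_def unit_disk_def norm_one_minus_cnj_mult)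

lemma exists_unit_near:
  assumes "cmod z < 1"
  obtains \<xi> where "cmod \<xi> = 1" "cmod (\<xi> - z) = 1 - cmod z"
proof (cases "z = 0")
  case True
  then show ?thesis using that[of 1] by simp
next
  case False
  have "sgn z - z = of_real (1 - cmod z) * sgn z"
    using False by (simp add: sgn_eq field_simps)
  then have "cmod (sgn z - z) = \<bar>1 - cmod z\<bar> * cmod (sgn z)" by (simp only: norm_mult norm_of_real)
  then have "cmod (sgn z - z) = 1 - cmod z"
    using assms False by (simp add: norm_sgn)
  then show ?thesis using that[of "sgn z"] False by (simp add: norm_sgn)
qed

text \<open>The radial projection of \<open>z\<close> is at distance 1 - |z|, so an aperture above 1
  leaves room for a ball of radius (\<sigma> - 1)(1 - |z|) around it. The minimum with 1 keeps this
  radius in the range of \<open>emeasure_circle_ball_ge\<close>.\<close>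

lemma emeasure_shadow_ge:
  assumes z: "cmod z < 1" and \<sigma>: "\<sigma> > 1"
  shows "ennreal (min (\<sigma> - 1) 1 * (1 - cmod z)) \<le> emeasure circle_measure (shadow \<sigma> z)"
proof -
  obtain \<xi> where \<xi>: "cmod \<xi> = 1" "cmod (\<xi> - z) = 1 - cmod z"
    using exists_unit_near[OF z] .
  define r where "r = min (\<sigma> - 1) 1 * (1 - cmod z)"
  have r0: "r > 0" using z \<sigma> by (simp add: r_def)
  have "r \<le> 1 * 1"
    unfolding r_def using z \<sigma> by (intro mult_mono) auto
  then have r2: "r \<le> 2" by simp
  have rle: "r \<le> (\<sigma> - 1) * (1 - cmod z)"
    unfolding r_def using z by (intro mult_right_mono) auto
  have "ennreal r \<le> emeasure circle_measure (ball \<xi> r)"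
    using \<xi>(1) r0 r2 by (rule emeasure_circle_ball_ge)
  also have "\<dots> \<le> emeasure circle_measure (shadow \<sigma> z)"
  proof (rule emeasure_mono_AE)
    show "AE x in circle_measure. x \<in> ball \<xi> r \<longrightarrow> x \<in> shadow \<sigma> z"
      using AE_circle_measure_norm
    proof eventually_elim
      fix x assume x: "cmod x = 1"
      show "x \<in> ball \<xi> r \<longrightarrow> x \<in> shadow \<sigma> z"
      proof
        assume "x \<in> ball \<xi> r"
        then have "cmod (x - \<xi>) < r" by (simp add: dist_norm norm_minus_commute)
        then have "cmod (x - z) < r + (1 - cmod z)"
          using norm_triangle_ineq[of "x - \<xi>" "\<xi> - z"] \<xi> by simp
        also have "\<dots> \<le> \<sigma> * (1 - cmod z)" using rle by (simp add: algebra_simps)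
        finally show "x \<in> shadow \<sigma> z"
          using z by (simp add: shadow_def mem_lusin_cone_iff[OF x])
      qed
    qed
  qed simp
  finally show ?thesis by (simp add: r_def)
qed

text \<open>72 is twice the 36 of \<open>emeasure_circle_ball_le\<close>, the 2 being lost to dyadic
  rounding. The sum of apertures measures how far apart two points of the shadows of one
  \<open>z\<close> can be, and the denominator comes from \<open>emeasure_shadow_ge\<close>.\<close>

definition aperture_const :: "real \<Rightarrow> real \<Rightarrow> real" where
  "aperture_const \<sigma>1 \<sigma>2 = 72 * (\<sigma>1 + \<sigma>2) / min (\<sigma>1 - 1) 1"

lemma aperture_const_pos: "\<sigma>1 > 1 \<Longrightarrow> \<sigma>2 > 1 \<Longrightarrow> aperture_const \<sigma>1 \<sigma>2 > 0"
  by (simp add: aperture_const_def)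

text \<open>A ball of radius R = (\<sigma>1 + \<sigma>2)(1 - |z|) about any point of the
  \<sigma>1-shadow on the circle contains the part of the \<sigma>2-shadow there. If
  \<open>E\<close> fills the latter with mass \<open>a\<close>, then almost all of the
  \<sigma>1-shadow lies in \<open>max_set E s\<close> as soon as \<open>s * R < a\<close>. One
  dyadic level with \<open>s * R\<close> close to \<open>a\<close> suffices; the whole sum appears
  because that level depends on \<open>z\<close>.\<close>

lemma emeasure_shadow_le_max_set:
  assumes z: "cmod z < 1" and \<sigma>: "\<sigma>1 > 1" "\<sigma>2 > 1" and [measurable]: "E \<in> sets borel"
  shows "emeasure circle_measure (E \<inter> shadow \<sigma>2 z) \<le> ennreal (aperture_const \<sigma>1 \<sigma>2) *
     (\<Sum>k. ennreal ((1/2) ^ k) * emeasure circle_measure (max_set E (36 / 2 ^ k) \<inter> shadow \<sigma>1 z))"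
    (is "_ \<le> _ * ?S")
proof (cases "measure circle_measure (E \<inter> shadow \<sigma>2 z) = 0")
  case True
  then show ?thesis by (simp add: circle.emeasure_eq_measure)
next
  case False
  define a where "a = measure circle_measure (E \<inter> shadow \<sigma>2 z)"
  have a: "a > 0" using False by (simp add: a_def zero_less_measure_iff)
  define x where "x = 1 - cmod z"
  have x: "x > 0" using z by (simp add: x_def)
  define R where "R = (\<sigma>1 + \<sigma>2) * x"
  have R: "R > 0" using x \<sigma> by (simp add: R_def)
  have ball_ge: "ennreal a \<le> emeasure circle_measure (E \<inter> ball \<zeta> R)"
    if \<zeta>: "cmod \<zeta> = 1" "\<zeta> \<in> shadow \<sigma>1 z" for \<zeta>
  proof -
    have "emeasure circle_measure (E \<inter> shadow \<sigma>2 z) \<le> emeasure circle_measure (E \<inter> ball \<zeta> R)"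
    proof (rule emeasure_mono_AE)
      show "AE \<xi> in circle_measure. \<xi> \<in> E \<inter> shadow \<sigma>2 z \<longrightarrow> \<xi> \<in> E \<inter> ball \<zeta> R"
        using AE_circle_measure_norm
      proof eventually_elim
        fix \<xi> assume \<xi>: "cmod \<xi> = 1"
        show "\<xi> \<in> E \<inter> shadow \<sigma>2 z \<longrightarrow> \<xi> \<in> E \<inter> ball \<zeta> R"
        proof
          assume m: "\<xi> \<in> E \<inter> shadow \<sigma>2 z"
          then have "cmod (\<xi> - z) < \<sigma>2 * x"
            by (simp add: shadow_def mem_lusin_cone_iff[OF \<xi>] x_def)
          moreover have "cmod (\<zeta> - z) < \<sigma>1 * x"
            using \<zeta>(2) by (simp add: shadow_def mem_lusin_cone_iff[OF \<zeta>(1)] x_def)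
          ultimately have "cmod (\<zeta> - \<xi>) < R"
            using norm_triangle_ineq4[of "\<zeta> - z" "\<xi> - z"] by (simp add: R_def algebra_simps)
          then show "\<xi> \<in> E \<inter> ball \<zeta> R" using m by (simp add: dist_norm)
        qed
      qed
    qed simp
    then show ?thesis by (simp add: a_def circle.emeasure_eq_measure)
  qed
  have shadow_le: "emeasure circle_measure (shadow \<sigma>1 z) \<le> emeasure circle_measure (max_set E s \<inter> shadow \<sigma>1 z)"
    if "s * R < a" "s > 0" for s
  proof (rule emeasure_mono_AE)
    show "AE \<xi> in circle_measure. \<xi> \<in> shadow \<sigma>1 z \<longrightarrow> \<xi> \<in> max_set E s \<inter> shadow \<sigma>1 z"
      using AE_circle_measure_norm
    proof eventually_elim
      fix \<xi> assume \<xi>: "cmod \<xi> = 1"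
      show "\<xi> \<in> shadow \<sigma>1 z \<longrightarrow> \<xi> \<in> max_set E s \<inter> shadow \<sigma>1 z"
      proof
        assume m: "\<xi> \<in> shadow \<sigma>1 z"
        have "ennreal (s * R) < ennreal a"
          using that a by (intro ennreal_lessI) auto
        also note ball_ge[OF \<xi> m]
        finally show "\<xi> \<in> max_set E s \<inter> shadow \<sigma>1 z"
          using R m by (auto simp: max_set_def)
      qed
    qed
  qed simp
  obtain \<zeta> where \<zeta>: "cmod \<zeta> = 1" "cmod (\<zeta> - z) = 1 - cmod z"
    using exists_unit_near[OF z] .
  have "\<zeta> \<in> shadow \<sigma>1 z"
    using \<zeta> z \<sigma> by (simp add: shadow_def mem_lusin_cone_iff[OF \<zeta>(1)])
  then have "ennreal a \<le> emeasure circle_measure (E \<inter> ball \<zeta> R)"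
    using ball_ge \<zeta> by blast
  also have "\<dots> \<le> emeasure circle_measure (ball \<zeta> R)" by (intro emeasure_mono) auto
  also have "\<dots> \<le> ennreal (36 * R)" using R by (rule emeasure_circle_ball_le)
  finally have a_le: "a \<le> 36 * R" using R by (simp add: ennreal_le_iff)
  define k where "k = (LEAST k. 36 * R / a < (2::real) ^ k)"
  have "\<exists>k. 36 * R / a < (2::real) ^ k" using real_arch_pow[of 2] by auto
  then have k: "36 * R / a < 2 ^ k" unfolding k_def by (rule LeastI_ex)
  \<comment> \<open>Minimality is to be used at the predecessor of \<open>k\<close>, where it gives
    the reverse estimate \<open>a * 2 ^ k \<le> 72 * R\<close>. The bound
    \<open>a \<le> 36 * R\<close> is what excludes 0.\<close>
  have "k \<noteq> 0"
  proof
    assume "k = 0"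
    then show False using k a a_le by (simp add: field_simps)
  qed
  then obtain j where j: "k = Suc j" by (cases k) auto
  have "\<not> 36 * R / a < 2 ^ j"
    using not_less_Least[of j "\<lambda>k. 36 * R / a < (2::real) ^ k"] j by (simp flip: k_def)
  then have k2: "a * 2 ^ k \<le> 72 * R" using a by (simp add: j field_simps)
  have sR: "36 / 2 ^ k * R < a" using k a by (simp add: field_simps)
  define c where "c = min (\<sigma>1 - 1) 1"
  have c: "c > 0" using \<sigma> by (simp add: c_def)
  have "a \<le> 72 * R / 2 ^ k" using k2 by (simp add: field_simps)
  also have "\<dots> = aperture_const \<sigma>1 \<sigma>2 * ((1/2) ^ k * (c * x))"
    using c by (simp add: aperture_const_def R_def power_one_over flip: c_def)
  finally have "ennreal a \<le> ennreal (aperture_const \<sigma>1 \<sigma>2 * ((1/2) ^ k * (c * x)))"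
    by (rule ennreal_leI)
  also have "\<dots> = ennreal (aperture_const \<sigma>1 \<sigma>2) * (ennreal ((1/2) ^ k) * ennreal (c * x))"
    using c x aperture_const_pos[OF \<sigma>] by (simp add: ennreal_mult)
  also have "\<dots> \<le> ennreal (aperture_const \<sigma>1 \<sigma>2) *
      (ennreal ((1/2) ^ k) * emeasure circle_measure (max_set E (36 / 2 ^ k) \<inter> shadow \<sigma>1 z))"
    using order_trans[OF emeasure_shadow_ge[OF z \<sigma>(1)] shadow_le[OF sR]]
    by (intro mult_left_mono) (auto simp: c_def x_def)
  also have "\<dots> \<le> ennreal (aperture_const \<sigma>1 \<sigma>2) * ?S"
  proof (intro mult_left_mono)
    show "ennreal ((1/2) ^ k) * emeasure circle_measure (max_set E (36 / 2 ^ k) \<inter> shadow \<sigma>1 z) \<le> ?S"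
      using sum_le_suminf[of "\<lambda>k. ennreal ((1/2) ^ k) * emeasure circle_measure (max_set E (36 / 2 ^ k) \<inter> shadow \<sigma>1 z)" "{k}"]
      by simp
  qed simp
  finally show ?thesis by (simp add: a_def circle.emeasure_eq_measure)
qed

section \<open>Cone integrals against a measure on the disk\<close>

locale disk_measure =
  fixes \<mu> :: "complex measure"
  assumes sets_disk_measure: "sets \<mu> = sets (restrict_space borel unit_disk)"
begin

lemma space_disk_measure: "space \<mu> = unit_disk"
  using sets_eq_imp_space_eq[OF sets_disk_measure] by (simp add: space_restrict_space)

lemma borel_measurable_disk:
  "g \<in> borel_measurable borel \<Longrightarrow> g \<in> borel_measurable \<mu>"
  by (subst measurable_cong_sets[OF sets_disk_measure refl]) (rule measurable_restrict_space1)

lemma borel_measurable_disk_continuous_on: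
  "continuous_on unit_disk g \<Longrightarrow> g \<in> borel_measurable \<mu>"
  by (subst measurable_cong_sets[OF sets_disk_measure refl]) (rule borel_measurable_continuous_on_restrict)

lemma id_measurable_disk: "(\<lambda>z. z) \<in> measurable \<mu> borel"
  by (rule borel_measurable_disk) simp

lemma sets_disk_measureI: "A \<in> sets borel \<Longrightarrow> A \<subseteq> unit_disk \<Longrightarrow> A \<in> sets \<mu>"
  by (simp add: sets_disk_measure sets_restrict_space_iff unit_disk_def)

lemma indicator_cone_measurable:
  "(indicator (lusin_cone \<sigma> \<xi>) :: complex \<Rightarrow> ennreal) \<in> borel_measurable \<mu>"
  by (intro borel_measurable_disk borel_measurable_indicator borel_open open_lusin_cone)

lemma cone_integral_measurable:
  assumes [measurable]: "w \<in> borel_measurable \<mu>"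
  shows "(\<lambda>\<xi>. \<integral>\<^sup>+z\<in>lusin_cone \<sigma> \<xi>. w z \<partial>\<mu>) \<in> borel_measurable borel"
proof -
  have "(\<lambda>\<xi>. \<integral>\<^sup>+z. w z * indicator {z. z \<in> lusin_cone \<sigma> \<xi>} z \<partial>\<mu>) \<in> borel_measurable borel"
  proof (rule borel_measurable_nn_integral_open_section)
    show "open {\<xi>. z \<in> lusin_cone \<sigma> \<xi>}" for z
      using open_shadow[of \<sigma> z] by (simp add: shadow_def)
    show "(\<lambda>z. w z * indicator {z. z \<in> lusin_cone \<sigma> \<xi>} z) \<in> borel_measurable \<mu>" for \<xi>
      by (simp only: Collect_mem_eq) (intro borel_measurable_times_ennreal assms indicator_cone_measurable)
  qed
  then show ?thesis by (simp only: Collect_mem_eq)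
qed

text \<open>Testing against \<open>E\<close> becomes a weight on the disk, so different apertures
  can be compared point by point through their shadows.\<close>

lemma set_integral_cone_integral:
  assumes sf: "sigma_finite_measure \<mu>" and [measurable]: "w \<in> borel_measurable \<mu>" "E \<in> sets borel"
  shows "(\<integral>\<^sup>+\<xi>\<in>E. (\<integral>\<^sup>+z\<in>lusin_cone \<sigma> \<xi>. w z \<partial>\<mu>) \<partial>circle_measure)
     = (\<integral>\<^sup>+z. w z * emeasure circle_measure (E \<inter> shadow \<sigma> z) \<partial>\<mu>)"
proof -
  interpret sigma_finite_measure \<mu> by fact
  interpret pair_sigma_finite circle_measure \<mu> ..
  define P where "P = {p :: complex \<times> complex. cmod (snd p) < 1 \<and>
      cmod (1 - cnj (fst p) * snd p) < \<sigma> * (1 - cmod (snd p))}"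
  have "open P"
    unfolding P_def by (intro open_Collect_conj open_Collect_less continuous_intros)
  then have [measurable]: "P \<in> sets (borel \<Otimes>\<^sub>M borel)"
    unfolding borel_prod by (rule borel_open)
  have P: "(\<xi>, z) \<in> P \<longleftrightarrow> z \<in> lusin_cone \<sigma> \<xi>" for \<xi> z
    by (auto simp: P_def lusin_cone_def unit_disk_def)
  \<comment> \<open>\<open>P\<close> is Borel in the product of two planes, whereas
    \<open>\<mu>\<close> lives on the trace algebra of the disk; the identity map transports
    measurability.\<close>
  have [measurable]: "(\<lambda>p. p) \<in> measurable (circle_measure \<Otimes>\<^sub>M \<mu>) (borel \<Otimes>\<^sub>M borel)"
  proof (rule measurable_pair)
    show "fst \<circ> (\<lambda>p. p) \<in> measurable (circle_measure \<Otimes>\<^sub>M \<mu>) borel"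
      using measurable_fst[of circle_measure \<mu>]
      by (simp add: comp_def measurable_cong_sets[OF refl sets_circle_measure])
    show "snd \<circ> (\<lambda>p. p) \<in> measurable (circle_measure \<Otimes>\<^sub>M \<mu>) borel"
      using measurable_compose[OF measurable_snd id_measurable_disk] by (simp add: comp_def)
  qed
  have [measurable]: "(\<lambda>p. indicator P p :: ennreal) \<in> borel_measurable (circle_measure \<Otimes>\<^sub>M \<mu>)"
    by (rule measurable_compose[where g = "indicator P" and N = "borel \<Otimes>\<^sub>M borel" and f = "\<lambda>p. p"]) measurable
  have meas: "(\<lambda>(\<xi>, z). w z * indicator P (\<xi>, z) * indicator E \<xi>) \<in> borel_measurable (circle_measure \<Otimes>\<^sub>M \<mu>)"
    by (simp add: split_beta') measurable
  have "(\<integral>\<^sup>+\<xi>\<in>E. (\<integral>\<^sup>+z\<in>lusin_cone \<sigma> \<xi>. w z \<partial>\<mu>) \<partial>circle_measure)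
      = (\<integral>\<^sup>+\<xi>. (\<integral>\<^sup>+z. w z * indicator P (\<xi>, z) * indicator E \<xi> \<partial>\<mu>) \<partial>circle_measure)"
    by (intro nn_integral_cong) (simp add: P indicator_def)
  also have "\<dots> = (\<integral>\<^sup>+z. (\<integral>\<^sup>+\<xi>. w z * indicator P (\<xi>, z) * indicator E \<xi> \<partial>circle_measure) \<partial>\<mu>)"
    by (rule Fubini'[symmetric]) (rule meas)
  also have "\<dots> = (\<integral>\<^sup>+z. w z * emeasure circle_measure (E \<inter> shadow \<sigma> z) \<partial>\<mu>)"
  proof (rule nn_integral_cong)
    fix z
    have "(\<integral>\<^sup>+\<xi>. w z * indicator P (\<xi>, z) * indicator E \<xi> \<partial>circle_measure)
       = (\<integral>\<^sup>+\<xi>. w z * indicator (E \<inter> shadow \<sigma> z) \<xi> \<partial>circle_measure)"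
      by (intro nn_integral_cong) (auto simp: P shadow_def indicator_def)
    also have "\<dots> = w z * emeasure circle_measure (E \<inter> shadow \<sigma> z)"
      by (rule nn_integral_cmult_indicator) simp
    finally show "(\<integral>\<^sup>+\<xi>. w z * indicator P (\<xi>, z) * indicator E \<xi> \<partial>circle_measure)
       = w z * emeasure circle_measure (E \<inter> shadow \<sigma> z)" .
  qed
  finally show ?thesis .
qed

text \<open>The semicontinuity argument with the roles of \<open>z\<close> and \<open>\<xi>\<close>
  exchanged: for fixed \<open>\<xi>\<close> the admissible \<open>z\<close> form an open
  cone.\<close>

lemma emeasure_shadow_measurable [measurable]:
  assumes [measurable]: "E \<in> sets borel"
  shows "(\<lambda>z. emeasure circle_measure (E \<inter> shadow \<sigma> z)) \<in> borel_measurable \<mu>"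
proof (rule borel_measurable_disk)
  have "(\<lambda>z. \<integral>\<^sup>+\<xi>. indicator E \<xi> * indicator {\<xi>. z \<in> lusin_cone \<sigma> \<xi>} \<xi> \<partial>circle_measure) \<in> borel_measurable borel"
  proof (rule borel_measurable_nn_integral_open_section)
    show "open {z. z \<in> lusin_cone \<sigma> \<xi>}" for \<xi>
      using open_lusin_cone[of \<sigma> \<xi>] by simp
    show "(\<lambda>\<xi>. (indicator E \<xi> :: ennreal) * indicator {\<xi>. z \<in> lusin_cone \<sigma> \<xi>} \<xi>) \<in> borel_measurable circle_measure" for z
      unfolding shadow_def[symmetric] by (intro borel_measurable_times_ennreal borel_measurable_indicator) simp_all
  qed
  moreover have "(\<integral>\<^sup>+\<xi>. indicator E \<xi> * indicator {\<xi>. z \<in> lusin_cone \<sigma> \<xi>} \<xi> \<partial>circle_measure)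
      = emeasure circle_measure (E \<inter> shadow \<sigma> z)" for z
    unfolding shadow_def[symmetric] indicator_inter_arith[symmetric] by simp
  ultimately show "(\<lambda>z. emeasure circle_measure (E \<inter> shadow \<sigma> z)) \<in> borel_measurable borel" by simp
qed

text \<open>Duality with indicators. At level 36 / 2^k the maximal inequality gives a superlevel set
  of measure at most 5 * 2^k m(E). Kolmogorov's inequality for aperture \<open>\<sigma>1\<close>
  turns this into a multiple of \<open>(2 ^ k) powr p\<close>, and the weight (1/2)^k leaves the
  convergent ratio \<open>v = 2 powr (p - 1)\<close>.\<close>

theorem weak_bounded_change_aperture:
  assumes sf: "sigma_finite_measure \<mu>" and [measurable]: "w \<in> borel_measurable \<mu>"
    and \<sigma>: "\<sigma>1 > 1" "\<sigma>2 > 1" and q: "q > 1" and N: "N > 0"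
    and bd: "weak_bounded q N (\<lambda>\<xi>. \<integral>\<^sup>+z\<in>lusin_cone \<sigma>1 \<xi>. w z \<partial>\<mu>)"
  shows "\<exists>N'>0. weak_bounded q N' (\<lambda>\<xi>. \<integral>\<^sup>+z\<in>lusin_cone \<sigma>2 \<xi>. w z \<partial>\<mu>)"
proof -
  define p where "p = 1 - 1/q"
  have p: "0 < p" "p < 1" using q by (auto simp: p_def)
  define v where "v = (2::real) powr (p - 1)"
  have v: "0 < v" "v < 1"
    using p powr_less_mono[of "p - 1" 0 "2::real"] by (auto simp: v_def)
  define A where "A = aperture_const \<sigma>1 \<sigma>2"
  have A: "A > 0" using \<sigma> by (simp add: A_def aperture_const_pos)
  define L where "L = kolmogorov_const q * N * 5 powr p"
  have L: "L > 0" using kolmogorov_const_pos[OF q] N by (simp add: L_def)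
  define K where "K = A * (L * (1 / (1 - v)))"
  have K: "K > 0" using A L v by (simp add: K_def)
  have "weak_bounded q K (\<lambda>\<xi>. \<integral>\<^sup>+z\<in>lusin_cone \<sigma>2 \<xi>. w z \<partial>\<mu>)"
  proof (rule weak_boundedI_set_integral)
    fix E :: "complex set" assume [measurable]: "E \<in> sets borel"
    define a where "a = measure circle_measure E"
    define U where "U k = max_set E (36 / 2 ^ k)" for k :: nat
    have [measurable]: "U k \<in> sets borel" for k by (simp add: U_def max_set_sets)
    have mU: "measure circle_measure (U k) \<le> 5 * 2 ^ k * a" for k
    proof -
      have "emeasure circle_measure (U k) \<le> ennreal (180 / (36 / 2 ^ k)) * emeasure circle_measure E"
        unfolding U_def by (rule emeasure_max_set_le) auto
      also have "\<dots> = ennreal (5 * 2 ^ k * a)"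
        by (simp add: circle.emeasure_eq_measure a_def ennreal_mult)
      finally show ?thesis
        by (simp add: circle.emeasure_eq_measure a_def)
    qed
    have summand: "ennreal ((1/2) ^ k) * (\<integral>\<^sup>+\<xi>\<in>U k. (\<integral>\<^sup>+z\<in>lusin_cone \<sigma>1 \<xi>. w z \<partial>\<mu>) \<partial>circle_measure)
       \<le> ennreal (L * a powr p * v ^ k)" for k
    proof -
      have "(\<integral>\<^sup>+\<xi>\<in>U k. (\<integral>\<^sup>+z\<in>lusin_cone \<sigma>1 \<xi>. w z \<partial>\<mu>) \<partial>circle_measure)
         \<le> ennreal (kolmogorov_const q * N * measure circle_measure (U k) powr p)"
        unfolding p_def
        by (rule weak_bounded_set_integral_le[OF bd cone_integral_measurable _ q N]) measurable
      also have "\<dots> \<le> ennreal (kolmogorov_const q * N * (5 * 2 ^ k * a) powr p)"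
        using mU[of k] kolmogorov_const_pos[OF q] N p
        by (intro ennreal_leI mult_left_mono powr_mono2) auto
      finally have "ennreal ((1/2) ^ k) * (\<integral>\<^sup>+\<xi>\<in>U k. (\<integral>\<^sup>+z\<in>lusin_cone \<sigma>1 \<xi>. w z \<partial>\<mu>) \<partial>circle_measure)
         \<le> ennreal ((1/2) ^ k) * ennreal (kolmogorov_const q * N * (5 * 2 ^ k * a) powr p)"
        by (intro mult_left_mono) auto
      also have "\<dots> = ennreal ((1/2) ^ k * (kolmogorov_const q * N * (5 * 2 ^ k * a) powr p))"
        by (rule ennreal_mult'[symmetric]) simp
      also have "(1/2) ^ k * (kolmogorov_const q * N * (5 * 2 ^ k * a) powr p) = L * a powr p * v ^ k"
      proof -
        have "v ^ k = (1/2) ^ k * (2 ^ k) powr p"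
          by (simp add: v_def powr_diff power_divide powr_power powr_powr mult.commute flip: powr_realpow)
        then show ?thesis by (simp add: L_def powr_mult mult_ac)
      qed
      finally show ?thesis .
    qed
    have "(\<integral>\<^sup>+\<xi>\<in>E. (\<integral>\<^sup>+z\<in>lusin_cone \<sigma>2 \<xi>. w z \<partial>\<mu>) \<partial>circle_measure)
        = (\<integral>\<^sup>+z. w z * emeasure circle_measure (E \<inter> shadow \<sigma>2 z) \<partial>\<mu>)"
      by (rule set_integral_cone_integral[OF sf]) measurable
    also have "\<dots> \<le> (\<integral>\<^sup>+z. ennreal A * (\<Sum>k. ennreal ((1/2) ^ k) * (w z * emeasure circle_measure (U k \<inter> shadow \<sigma>1 z))) \<partial>\<mu>)"
    proof (rule nn_integral_mono)
      fix z assume "z \<in> space \<mu>"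
      then have z: "cmod z < 1" by (simp add: space_disk_measure unit_disk_def)
      have "w z * emeasure circle_measure (E \<inter> shadow \<sigma>2 z)
        \<le> w z * (ennreal A * (\<Sum>k. ennreal ((1/2) ^ k) * emeasure circle_measure (U k \<inter> shadow \<sigma>1 z)))"
        unfolding A_def U_def by (intro mult_left_mono emeasure_shadow_le_max_set z \<sigma>) auto
      also have "\<dots> = ennreal A * (\<Sum>k. w z * (ennreal ((1/2) ^ k) * emeasure circle_measure (U k \<inter> shadow \<sigma>1 z)))"
        by (simp add: ennreal_suminf_cmult mult_ac)
      finally show "w z * emeasure circle_measure (E \<inter> shadow \<sigma>2 z)
        \<le> ennreal A * (\<Sum>k. ennreal ((1/2) ^ k) * (w z * emeasure circle_measure (U k \<inter> shadow \<sigma>1 z)))"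
        by (simp add: mult_ac)
    qed
    also have "\<dots> = ennreal A * (\<Sum>k. ennreal ((1/2) ^ k) * (\<integral>\<^sup>+z. w z * emeasure circle_measure (U k \<inter> shadow \<sigma>1 z) \<partial>\<mu>))"
      by (simp add: nn_integral_cmult nn_integral_suminf)
    also have "\<dots> = ennreal A * (\<Sum>k. ennreal ((1/2) ^ k) * (\<integral>\<^sup>+\<xi>\<in>U k. (\<integral>\<^sup>+z\<in>lusin_cone \<sigma>1 \<xi>. w z \<partial>\<mu>) \<partial>circle_measure))"
      by (simp add: set_integral_cone_integral[OF sf])
    also have "\<dots> \<le> ennreal A * (\<Sum>k. ennreal (L * a powr p * v ^ k))"
      by (intro mult_left_mono suminf_le summand) auto
    also have "(\<Sum>k. ennreal (L * a powr p * v ^ k)) = ennreal (L * a powr p * (1 / (1 - v)))"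
      using v L by (intro suminf_ennreal_eq sums_mult geometric_sums) auto
    also have "ennreal A * ennreal (L * a powr p * (1 / (1 - v))) = ennreal (K * a powr p)"
      using A by (simp add: K_def mult_ac flip: ennreal_mult')
    finally show "(\<integral>\<^sup>+\<xi>\<in>E. (\<integral>\<^sup>+z\<in>lusin_cone \<sigma>2 \<xi>. w z \<partial>\<mu>) \<partial>circle_measure)
       \<le> ennreal (K * measure circle_measure E powr (1 - 1/q))"
      by (simp add: a_def p_def)
  qed (use q K in \<open>auto intro: cone_integral_measurable\<close>)
  then show ?thesis using K by blast
qed

end

section \<open>Averages over Bergman disks\<close>

text \<open>The pseudohyperbolic disk of radius \<open>\<rho>\<close>, with the denominator of the
  Moebius map cleared so that openness in either variable is immediate.\<close>

definition pseudo_disk :: "real \<Rightarrow> complex \<Rightarrow> complex set" where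
  "pseudo_disk \<rho> z = {w. w \<in> unit_disk \<and> cmod (z - w) < \<rho> * cmod (1 - cnj z * w)}"

text \<open>On the disk \<open>bergman_dist\<close> is the inverse hyperbolic tangent of the
  pseudohyperbolic distance, which is strictly increasing.\<close>

lemma bergman_disk_eq_pseudo_disk:
  assumes z: "z \<in> unit_disk"
  shows "bergman_disk z \<tau> = pseudo_disk (tanh \<tau>) z"
proof -
  have "bergman_dist w z < \<tau> \<longleftrightarrow> cmod (z - w) < tanh \<tau> * cmod (1 - cnj z * w)" if w: "w \<in> unit_disk" for w
  proof -
    define x where "x = cmod (moebius z w)"
    have "cmod (Moebius_function 0 z w) < 1"
      using z w by (intro Moebius_function_norm_lt_1) (auto simp: unit_disk_def)
    moreover have "cmod (Moebius_function 0 z w) = x"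
      by (simp add: x_def moebius_def Moebius_function_def norm_divide norm_minus_commute)
    ultimately have x: "0 \<le> x" "x < 1" by (auto simp: x_def)
    have "cmod (cnj z * w) < 1"
      using z w mult_strict_mono'[of "cmod z" 1 "cmod w" 1] by (simp add: unit_disk_def norm_mult)
    then have nz: "1 - cnj z * w \<noteq> 0" by auto
    have "bergman_dist w z < \<tau> \<longleftrightarrow> ln ((1 + x) / (1 - x)) < 2 * \<tau>"
      by (auto simp: bergman_dist_def x_def)
    also have "\<dots> \<longleftrightarrow> (1 + x) / (1 - x) < exp (2 * \<tau>)"
      using x exp_less_cancel_iff[of "ln ((1 + x) / (1 - x))" "2 * \<tau>"] by simp
    also have "\<dots> \<longleftrightarrow> x < tanh \<tau>"
    proof -
      define e where "e = exp (2 * \<tau>)"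
      have e: "e > 0" by (simp add: e_def)
      have "exp (- 2 * \<tau>) = 1 / e" by (simp add: e_def exp_minus field_simps)
      then have "tanh \<tau> = (1 - 1 / e) / (1 + 1 / e)" by (simp only: tanh_real_altdef)
      also have "\<dots> = ((e - 1) / e) / ((e + 1) / e)" using e by (simp add: diff_divide_distrib add_divide_distrib)
      also have "\<dots> = (e - 1) / (e + 1)" using e by simp
      finally have "x < tanh \<tau> \<longleftrightarrow> x * (e + 1) < e - 1" using e by (simp add: pos_less_divide_eq)
      also have "\<dots> \<longleftrightarrow> (1 + x) / (1 - x) < e" using x by (simp add: pos_divide_less_eq algebra_simps)
      finally show ?thesis by (simp add: e_def)
    qed
    also have "\<dots> \<longleftrightarrow> cmod (z - w) < tanh \<tau> * cmod (1 - cnj z * w)"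
      using nz by (simp add: x_def moebius_def norm_divide divide_less_eq)
    finally show ?thesis .
  qed
  then show ?thesis by (auto simp: bergman_disk_def pseudo_disk_def)
qed

lemma norm_one_minus_cnj_mult_le:
  assumes "cmod z < 1"
  shows "cmod (1 - cnj z * w) \<le> 2 * (1 - cmod z) + cmod (z - w)"
proof -
  have "1 - cnj z * w = of_real (1 - (cmod z)\<^sup>2) + cnj z * (z - w)"
    using complex_norm_square[of z] by (simp add: algebra_simps)
  then have "cmod (1 - cnj z * w) \<le> cmod (of_real (1 - (cmod z)\<^sup>2)) + cmod (cnj z * (z - w))"
    by (metis norm_triangle_ineq)
  also have "cmod (of_real (1 - (cmod z)\<^sup>2)) = \<bar>1 - (cmod z)\<^sup>2\<bar>"
    by (simp only: norm_of_real)
  also have "\<bar>1 - (cmod z)\<^sup>2\<bar> = (1 + cmod z) * (1 - cmod z)"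
    using assms by (simp add: algebra_simps power2_eq_square abs_square_le_1 mult_le_one)
  also have "\<dots> \<le> 2 * (1 - cmod z)"
    using assms by (intro mult_right_mono) auto
  also have "cmod (cnj z * (z - w)) \<le> cmod (z - w)"
    using assms by (simp add: norm_mult mult_left_le_one_le)
  finally show ?thesis by simp
qed

text \<open>The estimate of the denominator contains |z - w| again, and \<open>\<rho> < 1\<close>
  allows it to be absorbed. Pseudohyperbolic disks thus sit in Euclidean disks of radius comparable
  to 1 - |z|.\<close>

lemma pseudo_disk_dist_le:
  assumes \<rho>: "0 < \<rho>" "\<rho> < 1" and z: "cmod z < 1"
    and lt: "cmod (z - w) < \<rho> * cmod (1 - cnj z * w)"
  shows "cmod (z - w) \<le> 2 * \<rho> / (1 - \<rho>) * (1 - cmod z)"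
proof -
  have "\<rho> * cmod (1 - cnj z * w) \<le> \<rho> * (2 * (1 - cmod z) + cmod (z - w))"
    using \<rho> norm_one_minus_cnj_mult_le[OF z] by (intro mult_left_mono) auto
  then have "cmod (z - w) * (1 - \<rho>) \<le> 2 * \<rho> * (1 - cmod z)"
    using lt by (simp add: algebra_simps)
  then show ?thesis using \<rho> by (simp add: field_simps)
qed

lemma pseudo_disk_sym: "cmod (1 - cnj z * w) = cmod (1 - cnj w * z)"
proof -
  have "1 - cnj z * w = cnj (1 - cnj w * z)" by (simp add: mult.commute)
  then show ?thesis by (metis complex_mod_cnj)
qed

lemma powr_comparable:
  fixes x y K p :: real
  assumes "x > 0" "y > 0" "K \<ge> 1" "x \<le> K * y" "y \<le> K * x"
  shows "x powr p \<le> K powr \<bar>p\<bar> * y powr p"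
proof (cases "p \<ge> 0")
  case True
  then have "x powr p \<le> (K * y) powr p" using assms by (intro powr_mono2) auto
  then show ?thesis using True by (simp add: powr_mult)
next
  case False
  have "y powr (-p) \<le> (K * x) powr (-p)" using False assms by (intro powr_mono2) auto
  also have "\<dots> = K powr (-p) * x powr (-p)" by (rule powr_mult)
  finally show ?thesis using False assms by (simp add: powr_minus field_simps)
qed

section \<open>Sigma-finiteness forced by weak bounds\<close>

lemma emeasure_lborel_complex_ball:
  assumes "r \<ge> 0"
  shows "emeasure lborel (ball (w::complex) r) = ennreal (pi * r\<^sup>2)"
  using emeasure_ball[OF assms, of w] by (simp add: unit_ball_vol_2)

text \<open>A ball about \<open>z0\<close> that lies in the cones of all vertices on a whole arc,
  and whose points see each other in their pseudohyperbolic disks. Infinite mass in it spreads to an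
  infinite integral for every vertex on the arc.\<close>

lemma lusin_box:
  assumes z0: "cmod z0 < 1" and \<sigma>: "\<sigma> > 1" and \<rho>: "\<rho> > 0"
  obtains \<delta> \<xi>0 where "\<delta> > 0" "\<delta> < 2" "cmod \<xi>0 = 1"
    "\<And>z. z \<in> ball z0 \<delta> \<Longrightarrow> cmod z < 1 \<and> 1 - cmod z \<le> 2 * (1 - cmod z0) \<and> 1 - cmod z0 \<le> 2 * (1 - cmod z)"
    "\<And>\<xi> z. cmod \<xi> = 1 \<Longrightarrow> \<xi> \<in> ball \<xi>0 \<delta> \<Longrightarrow> z \<in> ball z0 \<delta> \<Longrightarrow> z \<in> lusin_cone \<sigma> \<xi>"
    "\<And>z w. z \<in> ball z0 \<delta> \<Longrightarrow> w \<in> ball z0 \<delta> \<Longrightarrow> w \<in> pseudo_disk \<rho> z"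
proof -
  obtain \<xi>0 where \<xi>0: "cmod \<xi>0 = 1" "cmod (\<xi>0 - z0) = 1 - cmod z0"
    using exists_unit_near[OF z0] .
  \<comment> \<open>The bound 1/2 keeps 1 - |z| within a factor 2; \<rho>/4 puts two points of the
    ball, less than 2\<delta> apart, in each other's disks; the last bound says
    \<open>1 + 2 * \<epsilon> \<le> \<sigma> * (1 - \<epsilon>)\<close>, which is the cone
    condition.\<close>
  define \<epsilon> where "\<epsilon> = min (1/2) (min (\<rho>/4) ((\<sigma> - 1) / (2 + \<sigma>)))"
  have \<epsilon>0: "0 < \<epsilon>"
    using \<sigma> \<rho> by (simp add: \<epsilon>_def)
  have \<epsilon>1: "\<epsilon> \<le> 1/2"
    unfolding \<epsilon>_def by (rule min.cobounded1)
  have \<epsilon>2: "\<epsilon> \<le> \<rho>/4"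
    unfolding \<epsilon>_def by (rule min.coboundedI2[OF min.cobounded1])
  have "\<epsilon> \<le> (\<sigma> - 1) / (2 + \<sigma>)"
    unfolding \<epsilon>_def by (rule min.coboundedI2[OF min.cobounded2])
  then have "\<epsilon> * (2 + \<sigma>) \<le> \<sigma> - 1"
    using \<sigma> by (simp add: pos_le_divide_eq)
  then have \<epsilon>4: "1 + 2 * \<epsilon> \<le> \<sigma> * (1 - \<epsilon>)"
    by (simp add: algebra_simps)
  define x where "x = 1 - cmod z0"
  have x: "0 < x" "x \<le> 1" using z0 by (auto simp: x_def)
  define \<delta> where "\<delta> = \<epsilon> * x"
  have \<delta>: "\<delta> > 0" using x \<epsilon>0 by (simp add: \<delta>_def)
  have \<delta>x: "\<delta> \<le> x / 2" using \<epsilon>1 x mult_right_mono[of \<epsilon> "1/2" x] by (simp add: \<delta>_def)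
  have close: "x - \<delta> < 1 - cmod z" "1 - cmod z < x + \<delta>" if "z \<in> ball z0 \<delta>" for z
  proof -
    have "cmod (z0 - z) < \<delta>" using that by (simp add: dist_norm)
    then show "x - \<delta> < 1 - cmod z" "1 - cmod z < x + \<delta>"
      using norm_triangle_ineq2[of z0 z] norm_triangle_ineq2[of z z0]
      by (simp_all add: x_def norm_minus_commute)
  qed
  show thesis
  proof (rule that[of \<delta> \<xi>0])
    show "\<delta> > 0" "\<delta> < 2" "cmod \<xi>0 = 1" using \<delta> \<delta>x x \<xi>0 by auto
    show near: "cmod z < 1 \<and> 1 - cmod z \<le> 2 * (1 - cmod z0) \<and> 1 - cmod z0 \<le> 2 * (1 - cmod z)"
      if "z \<in> ball z0 \<delta>" for z
    proof -
      have "1 - cmod z \<le> 2 * x" using close[OF that] \<delta>x x by linarith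
      moreover have "x \<le> 2 * (1 - cmod z)" using close(1)[OF that] \<delta>x by (simp add: field_simps)
      moreover have "0 < 1 - cmod z" using close[OF that] \<delta>x x by linarith
      ultimately show ?thesis by (simp add: x_def)
    qed
    show "z \<in> lusin_cone \<sigma> \<xi>" if \<xi>: "cmod \<xi> = 1" "\<xi> \<in> ball \<xi>0 \<delta>" and z: "z \<in> ball z0 \<delta>" for \<xi> z
    proof -
      have "cmod (\<xi> - \<xi>0) < \<delta>"
        using \<xi>(2) by (simp add: dist_norm norm_minus_commute)
      moreover have "cmod (z0 - z) < \<delta>"
        using z by (simp add: dist_norm)
      moreover have "cmod (\<xi> - z) \<le> cmod (\<xi> - \<xi>0) + cmod (\<xi>0 - z0) + cmod (z0 - z)"
        using norm_triangle_ineq[of "\<xi> - z0" "z0 - z"] norm_triangle_ineq[of "\<xi> - \<xi>0" "\<xi>0 - z0"]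
        by simp
      moreover have "cmod (\<xi>0 - z0) = x" using \<xi>0(2) by (simp only: x_def)
      ultimately have "cmod (\<xi> - z) < \<delta> + x + \<delta>" by linarith
      also have "\<dots> = (1 + 2 * \<epsilon>) * x" by (simp add: \<delta>_def algebra_simps)
      also have "\<dots> \<le> \<sigma> * (1 - \<epsilon>) * x" using \<epsilon>4 x by (intro mult_right_mono) auto
      also have "\<dots> = \<sigma> * (x - \<delta>)" by (simp add: \<delta>_def algebra_simps)
      also have "\<dots> \<le> \<sigma> * (1 - cmod z)"
        using close[OF z] \<sigma> by (intro mult_left_mono) auto
      finally show ?thesis using near[OF z] by (simp add: mem_lusin_cone_iff[OF \<xi>(1)])
    qed
    show "w \<in> pseudo_disk \<rho> z" if z: "z \<in> ball z0 \<delta>" and w: "w \<in> ball z0 \<delta>" for z w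
    proof -
      have "cmod (z - w) < 2 * \<delta>"
        using z w dist_triangle2[of z w z0] by (simp add: dist_norm norm_minus_commute)
      also have "\<dots> \<le> 2 * (\<rho>/4 * x)"
        unfolding \<delta>_def using \<epsilon>2 x by (intro mult_left_mono mult_right_mono) auto
      also have "\<dots> = \<rho> * (x / 2)" by simp
      also have "\<dots> \<le> \<rho> * cmod (1 - cnj z * w)"
      proof (rule mult_left_mono)
        have "x / 2 \<le> 1 - cmod z" using near[OF z] by (simp add: x_def)
        also have "\<dots> \<le> 1 - cmod (cnj z * w)"
          using near[OF w] by (simp add: norm_mult mult_left_le)
        also have "\<dots> \<le> cmod (1 - cnj z * w)"
          using norm_triangle_ineq2[of 1 "cnj z * w"] by simp
        finally show "x / 2 \<le> cmod (1 - cnj z * w)" .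
      qed (use \<rho> in simp)
      finally show ?thesis using near[OF w] by (simp add: pseudo_disk_def unit_disk_def)
    qed
  qed
qed

context disk_measure
begin

text \<open>The plane is Lindelof, so countably many of the open sets of finite measure already
  cover the disk.\<close>

lemma sigma_finite_if_locally_finite:
  assumes "\<And>z. z \<in> unit_disk \<Longrightarrow> \<exists>V. open V \<and> z \<in> V \<and> V \<subseteq> unit_disk \<and> emeasure \<mu> V < \<infinity>"
  shows "sigma_finite_measure \<mu>"
proof
  define F where "F = {V. open V \<and> V \<subseteq> unit_disk \<and> emeasure \<mu> V < \<infinity>}"
  obtain F' where F': "F' \<subseteq> F" "countable F'" "\<Union>F' = \<Union>F"
    using Lindelof[of F] by (auto simp: F_def)
  have "\<Union>F = unit_disk" using assms by (fastforce simp: F_def)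
  moreover have "F' \<subseteq> sets \<mu>"
    using F'(1) by (auto simp: F_def intro!: sets_disk_measureI)
  moreover have "emeasure \<mu> a \<noteq> \<infinity>" if "a \<in> F'" for a
    using that F'(1) by (auto simp: F_def)
  ultimately show "\<exists>A. countable A \<and> A \<subseteq> sets \<mu> \<and> \<Union>A = space \<mu> \<and> (\<forall>a\<in>A. emeasure \<mu> a \<noteq> \<infinity>)"
    using F'(2,3) unfolding space_disk_measure by metis
qed

text \<open>Infinite mass near \<open>z0\<close> would make \<open>g\<close> infinite on an arc of
  positive length, which a weak bound excludes. The premise \<open>top\<close> offers both the cone
  and the disk inclusions, so one argument serves the cone integral and the averaged
  integral.\<close>

lemma sigma_finite_if_weak_bounded:
  assumes \<sigma>: "\<sigma> > 1" and \<rho>: "\<rho> > 0" and q: "q > 0"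
    and [measurable]: "g \<in> borel_measurable borel" and bd: "weak_bounded q N g"
    and top: "\<And>z0 \<delta> \<xi>. \<delta> > 0 \<Longrightarrow> cmod z0 < 1 \<Longrightarrow>
       (\<And>z. z \<in> ball z0 \<delta> \<Longrightarrow> cmod z < 1 \<and> 1 - cmod z \<le> 2 * (1 - cmod z0) \<and> 1 - cmod z0 \<le> 2 * (1 - cmod z)) \<Longrightarrow>
       ball z0 \<delta> \<subseteq> lusin_cone \<sigma> \<xi> \<Longrightarrow>
       (\<And>z. z \<in> ball z0 \<delta> \<Longrightarrow> ball z0 \<delta> \<subseteq> pseudo_disk \<rho> z) \<Longrightarrow>
       emeasure \<mu> (ball z0 \<delta>) = \<infinity> \<Longrightarrow> g \<xi> = \<infinity>"
  shows "sigma_finite_measure \<mu>"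
proof (rule sigma_finite_if_locally_finite)
  fix z0 assume "z0 \<in> unit_disk"
  then have z0: "cmod z0 < 1" by (simp add: unit_disk_def)
  obtain \<delta> \<xi>0 where \<delta>: "\<delta> > 0" "\<delta> < 2" "cmod \<xi>0 = 1"
    and near: "\<And>z. z \<in> ball z0 \<delta> \<Longrightarrow> cmod z < 1 \<and> 1 - cmod z \<le> 2 * (1 - cmod z0) \<and> 1 - cmod z0 \<le> 2 * (1 - cmod z)"
    and cone: "\<And>\<xi> z. cmod \<xi> = 1 \<Longrightarrow> \<xi> \<in> ball \<xi>0 \<delta> \<Longrightarrow> z \<in> ball z0 \<delta> \<Longrightarrow> z \<in> lusin_cone \<sigma> \<xi>"
    and ps: "\<And>z w. z \<in> ball z0 \<delta> \<Longrightarrow> w \<in> ball z0 \<delta> \<Longrightarrow> w \<in> pseudo_disk \<rho> z"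
    using lusin_box[OF z0 \<sigma> \<rho>] by metis
  have "emeasure \<mu> (ball z0 \<delta>) \<noteq> \<infinity>"
  proof
    assume inf: "emeasure \<mu> (ball z0 \<delta>) = \<infinity>"
    have "ennreal \<delta> \<le> emeasure circle_measure (ball \<xi>0 \<delta>)"
      using \<delta> by (intro emeasure_circle_ball_ge) auto
    also have "\<dots> \<le> emeasure circle_measure {\<xi>. g \<xi> = \<infinity>}"
    proof (rule emeasure_mono_AE)
      show "AE \<xi> in circle_measure. \<xi> \<in> ball \<xi>0 \<delta> \<longrightarrow> \<xi> \<in> {\<xi>. g \<xi> = \<infinity>}"
        using AE_circle_measure_norm
      proof eventually_elim
        fix \<xi> assume \<xi>: "cmod \<xi> = 1"
        show "\<xi> \<in> ball \<xi>0 \<delta> \<longrightarrow> \<xi> \<in> {\<xi>. g \<xi> = \<infinity>}"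
        proof
          assume "\<xi> \<in> ball \<xi>0 \<delta>"
          then have c: "ball z0 \<delta> \<subseteq> lusin_cone \<sigma> \<xi>" using cone[OF \<xi>] by auto
          have p: "ball z0 \<delta> \<subseteq> pseudo_disk \<rho> z" if "z \<in> ball z0 \<delta>" for z
            using ps[OF that] by auto
          have "g \<xi> = \<infinity>" by (rule top[OF \<delta>(1) z0 near c p inf])
          then show "\<xi> \<in> {\<xi>. g \<xi> = \<infinity>}" by simp
        qed
      qed
    qed measurable
    also have "\<dots> = 0"
      using weak_bounded_imp_measure_top_eq_0[OF bd _ q] by (simp add: circle.emeasure_eq_measure)
    finally show False using \<delta> by simp
  qed
  then show "\<exists>V. open V \<and> z0 \<in> V \<and> V \<subseteq> unit_disk \<and> emeasure \<mu> V < \<infinity>"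
    using \<delta> near by (intro exI[of _ "ball z0 \<delta>"]) (auto simp: unit_disk_def less_top)
qed

end

section \<open>The kernel behind the averaged integral\<close>

lemma sets_area_measure [simp, measurable_cong]: "sets area_measure = sets borel"
  by (simp add: area_measure_def)

lemma space_area_measure [simp]: "space area_measure = UNIV"
  by (simp add: area_measure_def)

lemma weight_measurable [measurable]: "(\<lambda>z. ennreal ((1 - cmod z) powr p)) \<in> borel_measurable borel"
  by measurable

lemma open_pseudo_disk_rel:
  "open {(z, w). w \<in> unit_disk \<and> cmod (z - w) < \<rho> * cmod (1 - cnj z * w)}"
proof -
  have "open {p. cmod (snd p) < 1 \<and> cmod (fst p - snd p) < \<rho> * cmod (1 - cnj (fst p) * snd p)}"
    by (intro open_Collect_conj open_Collect_less continuous_intros)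
  then show ?thesis by (simp add: split_beta' unit_disk_def)
qed

lemma open_pseudo_disk: "open (pseudo_disk \<rho> z)"
proof -
  have "open {w. cmod w < 1 \<and> cmod (z - w) < \<rho> * cmod (1 - cnj z * w)}"
    by (intro open_Collect_conj open_Collect_less continuous_intros)
  then show ?thesis by (simp add: pseudo_disk_def unit_disk_def)
qed

lemma open_pseudo_disk_section: "open {z. w \<in> pseudo_disk \<rho> z}"
proof (cases "w \<in> unit_disk")
  case True
  have "open {z. cmod (z - w) < \<rho> * cmod (1 - cnj z * w)}"
    by (intro open_Collect_less continuous_intros)
  then show ?thesis using True by (simp add: pseudo_disk_def)
qed (simp add: pseudo_disk_def)

text \<open>The division by pi is the density of \<open>area_measure\<close>. Integrating over
  \<open>w\<close> against \<open>\<mu>\<close> gives the averaged integrand, integrating over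
  \<open>z\<close> gives a weight to be compared with a cone integrand.\<close>

definition averaging_kernel :: "real \<Rightarrow> real \<Rightarrow> real \<Rightarrow> complex \<Rightarrow> complex \<Rightarrow> complex \<Rightarrow> ennreal" where
  "averaging_kernel \<sigma> \<rho> p \<xi> z w =
     ennreal ((1 - cmod z) powr p / pi) * indicator (lusin_cone \<sigma> \<xi>) z * indicator (pseudo_disk \<rho> z) w"

lemma averaging_kernel_integral_measurable:
  "(\<lambda>w. \<integral>\<^sup>+z. averaging_kernel \<sigma> \<rho> p \<xi> z w \<partial>lborel) \<in> borel_measurable borel"
proof -
  have [measurable]: "lusin_cone \<sigma> \<xi> \<in> sets borel" "{z. w \<in> pseudo_disk \<rho> z} \<in> sets borel" for w
    by (auto intro: borel_open open_lusin_cone open_pseudo_disk_section)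
  have "(\<lambda>w. \<integral>\<^sup>+z. (ennreal ((1 - cmod z) powr p / pi) * indicator (lusin_cone \<sigma> \<xi>) z)
      * indicator {z. w \<in> pseudo_disk \<rho> z} z \<partial>lborel) \<in> borel_measurable borel"
    by (rule borel_measurable_nn_integral_open_section) (simp add: open_pseudo_disk, measurable)
  then show ?thesis by (simp add: averaging_kernel_def indicator_def)
qed

text \<open>If \<open>w\<close> is in the disk about \<open>z\<close>, then 1 - |z| and 1 - |w|
  agree up to the factor \<open>K\<close> and |z - w| < K (1 - |w|). So \<open>w\<close> lies in a
  wider cone, while \<open>z\<close> is confined to a ball whose area supplies the two extra
  powers.\<close>

lemma averaging_kernel_integral_le:
  assumes \<rho>: "0 < \<rho>" "\<rho> < 1" and \<sigma>: "\<sigma> > 1" and \<xi>: "cmod \<xi> = 1" and w: "cmod w < 1"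
  defines "K \<equiv> 1 + 2 * \<rho> / (1 - \<rho>)"
  shows "(\<integral>\<^sup>+z. averaging_kernel \<sigma> \<rho> p \<xi> z w \<partial>lborel)
    \<le> ennreal (K powr \<bar>p\<bar> * K\<^sup>2) * (ennreal ((1 - cmod w) powr (p + 2)) * indicator (lusin_cone (\<sigma> * K + K) \<xi>) w)"
proof -
  define x where "x = 1 - cmod w"
  have x: "x > 0" using w by (simp add: x_def)
  have K: "K \<ge> 1" using \<rho> by (simp add: K_def)
  have bound: "averaging_kernel \<sigma> \<rho> p \<xi> z w \<le>
     ennreal (K powr \<bar>p\<bar> * x powr p / pi) * indicator (lusin_cone (\<sigma> * K + K) \<xi>) w * indicator (ball w (K * x)) z" for z
  proof (cases "z \<in> lusin_cone \<sigma> \<xi> \<and> w \<in> pseudo_disk \<rho> z")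
    case True
    define y where "y = 1 - cmod z"
    have z: "cmod z < 1" "cmod (\<xi> - z) < \<sigma> * y"
      using True by (auto simp: mem_lusin_cone_iff[OF \<xi>] y_def)
    have y: "y > 0" using z by (simp add: y_def)
    have lt: "cmod (z - w) < \<rho> * cmod (1 - cnj z * w)"
      using True by (simp add: pseudo_disk_def)
    have d1: "cmod (z - w) \<le> 2 * \<rho> / (1 - \<rho>) * y"
      unfolding y_def by (rule pseudo_disk_dist_le[OF \<rho> z(1) lt])
    have d2: "cmod (z - w) \<le> 2 * \<rho> / (1 - \<rho>) * x"
      using pseudo_disk_dist_le[OF \<rho> w, of z] lt pseudo_disk_sym[of z w]
      by (simp add: x_def norm_minus_commute)
    have d3: "cmod (z - w) < K * x" using d2 x by (simp add: K_def algebra_simps)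
    have "\<bar>x - y\<bar> \<le> cmod (z - w)"
      using norm_triangle_ineq3[of z w] by (simp add: x_def y_def)
    then have xy: "x \<le> y + cmod (z - w)" "y \<le> x + cmod (z - w)" by auto
    have xK: "x \<le> K * y" using xy(1) d1 by (simp add: K_def distrib_right)
    have yK: "y \<le> K * x" using xy(2) d2 by (simp add: K_def distrib_right)
    have "cmod (\<xi> - w) \<le> cmod (\<xi> - z) + cmod (z - w)"
      using norm_triangle_ineq[of "\<xi> - z" "z - w"] by simp
    also have "\<dots> < \<sigma> * y + K * x" using z(2) d3 by simp
    also have "\<dots> \<le> \<sigma> * (K * x) + K * x" using yK \<sigma> by simp
    finally have "w \<in> lusin_cone (\<sigma> * K + K) \<xi>"
      using w by (simp add: mem_lusin_cone_iff[OF \<xi>] x_def algebra_simps)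
    moreover have "z \<in> ball w (K * x)"
      using d3 by (simp add: dist_norm norm_minus_commute)
    moreover have "y powr p / pi \<le> K powr \<bar>p\<bar> * x powr p / pi"
      using powr_comparable[OF y x K yK xK, of p] by (simp add: divide_right_mono)
    ultimately show ?thesis
      using True by (simp add: averaging_kernel_def y_def ennreal_leI)
  qed (auto simp: averaging_kernel_def)
  have "(\<integral>\<^sup>+z. averaging_kernel \<sigma> \<rho> p \<xi> z w \<partial>lborel) \<le>
     (\<integral>\<^sup>+z. ennreal (K powr \<bar>p\<bar> * x powr p / pi) * indicator (lusin_cone (\<sigma> * K + K) \<xi>) w * indicator (ball w (K * x)) z \<partial>lborel)"
    by (intro nn_integral_mono bound)
  also have "\<dots> = ennreal (K powr \<bar>p\<bar> * x powr p / pi) * indicator (lusin_cone (\<sigma> * K + K) \<xi>) w * emeasure lborel (ball w (K * x))"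
    by (rule nn_integral_cmult_indicator) simp
  also have "emeasure lborel (ball w (K * x)) = ennreal (pi * (K * x)\<^sup>2)"
    using K x by (intro emeasure_lborel_complex_ball) auto
  also have "ennreal (K powr \<bar>p\<bar> * x powr p / pi) * indicator (lusin_cone (\<sigma> * K + K) \<xi>) w * ennreal (pi * (K * x)\<^sup>2)
     = (ennreal (K powr \<bar>p\<bar> * x powr p / pi) * ennreal (pi * (K * x)\<^sup>2)) * indicator (lusin_cone (\<sigma> * K + K) \<xi>) w"
    by (simp add: mult_ac)
  also have "ennreal (K powr \<bar>p\<bar> * x powr p / pi) * ennreal (pi * (K * x)\<^sup>2) = ennreal (K powr \<bar>p\<bar> * x powr p / pi * (pi * (K * x)\<^sup>2))"
    by (rule ennreal_mult[symmetric]) auto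
  also have "K powr \<bar>p\<bar> * x powr p / pi * (pi * (K * x)\<^sup>2) = (K powr \<bar>p\<bar> * K\<^sup>2) * x powr (p + 2)"
    using x by (simp add: powr_add power_mult_distrib)
  also have "ennreal ((K powr \<bar>p\<bar> * K\<^sup>2) * x powr (p + 2)) = ennreal (K powr \<bar>p\<bar> * K\<^sup>2) * ennreal (x powr (p + 2))"
    by (rule ennreal_mult) auto
  finally show ?thesis by (simp add: x_def mult.assoc)
qed

text \<open>If \<open>w\<close> is in the narrower cone, the gap between the apertures leaves room
  for a ball about \<open>w\<close>, of radius proportional to 1 - |w|, on which the kernel is
  bounded below. The constant is uniform in \<open>\<xi>\<close> and \<open>w\<close>.\<close>

lemma averaging_kernel_integral_ge:
  assumes \<rho>: "0 < \<rho>" and \<sigma>: "\<sigma> > 1" and \<sigma>': "0 < \<sigma>'" "\<sigma>' < \<sigma>"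
  shows "\<exists>c>0. \<forall>\<xi> w. cmod \<xi> = 1 \<longrightarrow> w \<in> lusin_cone \<sigma>' \<xi> \<longrightarrow>
     ennreal ((1 - cmod w) powr (p + 2)) \<le> ennreal c * (\<integral>\<^sup>+z. averaging_kernel \<sigma> \<rho> p \<xi> z w \<partial>lborel)"
proof -
  \<comment> \<open>The three bounds make 1 - |z| and 1 - |w| comparable, put \<open>w\<close> in
    the disk about \<open>z\<close>, and give
    \<open>\<sigma>' + \<epsilon> \<le> \<sigma> * (1 - \<epsilon>)\<close> for the cone.\<close>
  define \<epsilon> where "\<epsilon> = min (1/2) (min (\<rho>/2) ((\<sigma> - \<sigma>') / (1 + \<sigma>)))"
  have \<epsilon>0: "0 < \<epsilon>"
    using \<sigma> \<sigma>' \<rho> by (simp add: \<epsilon>_def)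
  have \<epsilon>1: "\<epsilon> \<le> 1/2"
    unfolding \<epsilon>_def by (rule min.cobounded1)
  have \<epsilon>2: "\<epsilon> \<le> \<rho>/2"
    unfolding \<epsilon>_def by (rule min.coboundedI2[OF min.cobounded1])
  have "\<epsilon> \<le> (\<sigma> - \<sigma>') / (1 + \<sigma>)"
    unfolding \<epsilon>_def by (rule min.coboundedI2[OF min.cobounded2])
  then have "\<epsilon> * (1 + \<sigma>) \<le> \<sigma> - \<sigma>'"
    using \<sigma> by (simp add: pos_le_divide_eq)
  then have \<epsilon>4: "\<sigma>' + \<epsilon> \<le> \<sigma> * (1 - \<epsilon>)"
    by (simp add: algebra_simps)
  define k where "k = 2 powr \<bar>p\<bar> * pi"
  have k: "k > 0" by (simp add: k_def)
  define c where "c = k / (pi * \<epsilon>\<^sup>2)"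
  have c: "c > 0" using k \<epsilon>0 by (simp add: c_def)
  have "ennreal ((1 - cmod w) powr (p + 2)) \<le> ennreal c * (\<integral>\<^sup>+z. averaging_kernel \<sigma> \<rho> p \<xi> z w \<partial>lborel)"
    if \<xi>: "cmod \<xi> = 1" and wc: "w \<in> lusin_cone \<sigma>' \<xi>" for \<xi> w
  proof -
    define x where "x = 1 - cmod w"
    have w: "cmod w < 1" "cmod (\<xi> - w) < \<sigma>' * x"
      using wc by (auto simp: mem_lusin_cone_iff[OF \<xi>] x_def)
    have x: "x > 0" using w by (simp add: x_def)
    have bound: "ennreal (x powr p / k) * indicator (ball w (\<epsilon> * x)) z \<le> averaging_kernel \<sigma> \<rho> p \<xi> z w" for z
    proof (cases "z \<in> ball w (\<epsilon> * x)")
      case True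
      define y where "y = 1 - cmod z"
      have zw: "cmod (z - w) < \<epsilon> * x" using True by (simp add: dist_norm norm_minus_commute)
      have "\<bar>x - y\<bar> \<le> cmod (z - w)"
        using norm_triangle_ineq3[of z w] by (simp add: x_def y_def)
      then have xy: "x - \<epsilon> * x < y" "y < x + \<epsilon> * x" using zw by auto
      have ex: "\<epsilon> * x \<le> 1/2 * x" using \<epsilon>1 x by (intro mult_right_mono) auto
      have y: "y > 0" using xy(1) ex x by linarith
      have yx: "y \<le> 2 * x" using xy(2) ex x by linarith
      have xy2: "x \<le> 2 * y" using xy(1) ex by linarith
      have z: "cmod z < 1" using y by (simp add: y_def)
      have "cmod (\<xi> - z) \<le> cmod (\<xi> - w) + cmod (z - w)"
        using norm_triangle_ineq4[of "\<xi> - w" "z - w"] by simp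
      also have "\<dots> < (\<sigma>' + \<epsilon>) * x" using w(2) zw by (simp add: distrib_right)
      also have "\<dots> \<le> \<sigma> * (1 - \<epsilon>) * x" using \<epsilon>4 x by (intro mult_right_mono) auto
      also have "\<dots> = \<sigma> * (x - \<epsilon> * x)" by (simp add: algebra_simps)
      also have "\<dots> \<le> \<sigma> * y" using xy(1) \<sigma> by (intro mult_left_mono) auto
      finally have zc: "z \<in> lusin_cone \<sigma> \<xi>" using z by (simp add: mem_lusin_cone_iff[OF \<xi>] y_def)
      have "x \<le> cmod (1 - cnj z * w)"
      proof -
        have "x \<le> 1 - cmod (cnj z * w)"
          using z by (simp add: x_def norm_mult mult_left_le_one_le)
        also have "\<dots> \<le> cmod (1 - cnj z * w)"
          using norm_triangle_ineq2[of 1 "cnj z * w"] by simp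
        finally show ?thesis .
      qed
      then have "\<rho> * x \<le> \<rho> * cmod (1 - cnj z * w)" using \<rho> by simp
      moreover have "\<epsilon> * x \<le> \<rho> * x" using \<epsilon>2 \<rho> x by (intro mult_right_mono) auto
      ultimately have "w \<in> pseudo_disk \<rho> z"
        using zw w by (simp add: pseudo_disk_def unit_disk_def)
      moreover have "x powr p / k \<le> y powr p / pi"
        using powr_comparable[OF x y _ xy2 yx, of p] by (simp add: k_def field_simps)
      ultimately show ?thesis
        using True zc by (simp add: averaging_kernel_def y_def ennreal_leI)
    qed simp
    have "x powr (p + 2) = c * (x powr p / k * (pi * (\<epsilon> * x)\<^sup>2))"
      using x k \<epsilon>0 by (simp add: c_def powr_add power_mult_distrib)
    then have "ennreal (x powr (p + 2)) = ennreal c * (ennreal (x powr p / k) * ennreal (pi * (\<epsilon> * x)\<^sup>2))"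
      using c k by (simp flip: ennreal_mult)
    also have "ennreal (pi * (\<epsilon> * x)\<^sup>2) = emeasure lborel (ball w (\<epsilon> * x))"
      using x \<epsilon>0 by (intro emeasure_lborel_complex_ball[symmetric]) auto
    also have "ennreal (x powr p / k) * emeasure lborel (ball w (\<epsilon> * x))
       = (\<integral>\<^sup>+z. ennreal (x powr p / k) * indicator (ball w (\<epsilon> * x)) z \<partial>lborel)"
      by (rule nn_integral_cmult_indicator[symmetric]) simp
    also have "ennreal c * \<dots> \<le> ennreal c * (\<integral>\<^sup>+z. averaging_kernel \<sigma> \<rho> p \<xi> z w \<partial>lborel)"
      by (intro mult_left_mono nn_integral_mono bound) simp
    finally show ?thesis by (simp add: x_def)
  qed
  then show ?thesis using c by blast
qed

context disk_measure
begin

lemma pseudo_disk_sets [measurable]: "pseudo_disk \<rho> z \<in> sets \<mu>"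
  by (rule sets_disk_measureI[OF borel_open[OF open_pseudo_disk]]) (auto simp: pseudo_disk_def)

lemma emeasure_pseudo_disk_measurable [measurable]:
  "(\<lambda>z. emeasure \<mu> (pseudo_disk \<rho> z)) \<in> borel_measurable borel"
proof -
  have "(\<lambda>z. \<integral>\<^sup>+w. 1 * indicator {w. w \<in> pseudo_disk \<rho> z} w \<partial>\<mu>) \<in> borel_measurable borel"
    by (rule borel_measurable_nn_integral_open_section) (auto intro: open_pseudo_disk_section)
  then show ?thesis by simp
qed

lemma averaged_cone_integral_measurable:
  "(\<lambda>\<xi>. \<integral>\<^sup>+z\<in>lusin_cone \<sigma> \<xi>. ennreal ((1 - cmod z) powr p) * emeasure \<mu> (pseudo_disk \<rho> z) \<partial>area_measure)
     \<in> borel_measurable borel"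
proof -
  have [measurable]: "lusin_cone \<sigma> \<xi> \<in> sets borel" for \<xi>
    by (rule borel_open[OF open_lusin_cone])
  have "(\<lambda>\<xi>. \<integral>\<^sup>+z. ennreal ((1 - cmod z) powr p) * emeasure \<mu> (pseudo_disk \<rho> z)
           * indicator {z. z \<in> lusin_cone \<sigma> \<xi>} z \<partial>area_measure) \<in> borel_measurable borel"
  proof (rule borel_measurable_nn_integral_open_section)
    show "open {\<xi>. z \<in> lusin_cone \<sigma> \<xi>}" for z
      using open_shadow[of \<sigma> z] by (simp add: shadow_def)
    show "(\<lambda>z. ennreal ((1 - cmod z) powr p) * emeasure \<mu> (pseudo_disk \<rho> z)
           * indicator {z. z \<in> lusin_cone \<sigma> \<xi>} z) \<in> borel_measurable area_measure" for \<xi>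
      by (simp only: Collect_mem_eq) measurable
  qed
  then show ?thesis by (simp only: Collect_mem_eq)
qed

lemma averaged_cone_integral_eq:
  assumes sf: "sigma_finite_measure \<mu>"
  shows "(\<integral>\<^sup>+z\<in>lusin_cone \<sigma> \<xi>. ennreal ((1 - cmod z) powr p) * emeasure \<mu> (pseudo_disk \<rho> z) \<partial>area_measure)
    = (\<integral>\<^sup>+w. (\<integral>\<^sup>+z. averaging_kernel \<sigma> \<rho> p \<xi> z w \<partial>lborel) \<partial>\<mu>)"
proof -
  interpret sigma_finite_measure \<mu> by fact
  interpret pair_sigma_finite lborel \<mu> ..
  have [measurable]: "lusin_cone \<sigma> \<xi> \<in> sets borel" for \<xi>
    by (rule borel_open[OF open_lusin_cone])
  have [measurable]: "unit_disk \<in> sets borel" by (simp add: unit_disk_def)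
  define R where "R = {(z, w). w \<in> unit_disk \<and> cmod (z - w) < \<rho> * cmod (1 - cnj z * w)}"
  have [measurable]: "R \<in> sets (borel \<Otimes>\<^sub>M borel)"
    unfolding borel_prod R_def by (rule borel_open[OF open_pseudo_disk_rel])
  have R: "(z, w) \<in> R \<longleftrightarrow> w \<in> pseudo_disk \<rho> z" for z w
    by (simp add: R_def pseudo_disk_def)
  have [measurable]: "(\<lambda>p. p) \<in> measurable (lborel \<Otimes>\<^sub>M \<mu>) (borel \<Otimes>\<^sub>M borel)"
  proof (rule measurable_pair)
    show "fst \<circ> (\<lambda>p. p) \<in> measurable (lborel \<Otimes>\<^sub>M \<mu>) borel"
      using measurable_fst[of lborel \<mu>]
      by (simp add: comp_def measurable_cong_sets[OF refl sets_lborel])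
    show "snd \<circ> (\<lambda>p. p) \<in> measurable (lborel \<Otimes>\<^sub>M \<mu>) borel"
      using measurable_compose[OF measurable_snd id_measurable_disk] by (simp add: comp_def)
  qed
  have [measurable]: "(\<lambda>p. indicator R p :: ennreal) \<in> borel_measurable (lborel \<Otimes>\<^sub>M \<mu>)"
    by (rule measurable_compose[where g = "indicator R" and N = "borel \<Otimes>\<^sub>M borel" and f = "\<lambda>p. p"]) measurable
  have kernel: "averaging_kernel \<sigma> \<rho> p \<xi> z w =
     ennreal ((1 - cmod z) powr p / pi) * indicator (lusin_cone \<sigma> \<xi>) z * indicator R (z, w)" for z w
    by (simp add: averaging_kernel_def indicator_def R)
  have [measurable]: "(\<lambda>z. ennreal ((1 - cmod z) powr p / pi)) \<in> borel_measurable borel"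
    by measurable
  have meas: "(\<lambda>(z, w). averaging_kernel \<sigma> \<rho> p \<xi> z w) \<in> borel_measurable (lborel \<Otimes>\<^sub>M \<mu>)"
    unfolding kernel by (simp add: split_beta') measurable
  have "(\<integral>\<^sup>+z\<in>lusin_cone \<sigma> \<xi>. ennreal ((1 - cmod z) powr p) * emeasure \<mu> (pseudo_disk \<rho> z) \<partial>area_measure)
     = (\<integral>\<^sup>+z. ennreal (indicator unit_disk z / pi) * (ennreal ((1 - cmod z) powr p) *
           emeasure \<mu> (pseudo_disk \<rho> z) * indicator (lusin_cone \<sigma> \<xi>) z) \<partial>lborel)"
    unfolding area_measure_def by (rule nn_integral_density) measurable
  also have "\<dots> = (\<integral>\<^sup>+z. (\<integral>\<^sup>+w. averaging_kernel \<sigma> \<rho> p \<xi> z w \<partial>\<mu>) \<partial>lborel)"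
  proof (rule nn_integral_cong)
    fix z
    have "(\<integral>\<^sup>+w. averaging_kernel \<sigma> \<rho> p \<xi> z w \<partial>\<mu>) =
        ennreal ((1 - cmod z) powr p / pi) * indicator (lusin_cone \<sigma> \<xi>) z * emeasure \<mu> (pseudo_disk \<rho> z)"
      unfolding averaging_kernel_def by (rule nn_integral_cmult_indicator) simp
    also have "\<dots> = ennreal (indicator unit_disk z / pi) * (ennreal ((1 - cmod z) powr p) *
           emeasure \<mu> (pseudo_disk \<rho> z) * indicator (lusin_cone \<sigma> \<xi>) z)"
    proof (cases "z \<in> lusin_cone \<sigma> \<xi>")
      case True
      then have "z \<in> unit_disk" by (simp add: lusin_cone_def)
      moreover have "ennreal ((1 - cmod z) powr p / pi) = ennreal (1 / pi) * ennreal ((1 - cmod z) powr p)"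
        by (subst ennreal_mult'[symmetric]) auto
      ultimately show ?thesis using True by (simp add: mult_ac)
    qed simp
    finally show "ennreal (indicator unit_disk z / pi) * (ennreal ((1 - cmod z) powr p) *
           emeasure \<mu> (pseudo_disk \<rho> z) * indicator (lusin_cone \<sigma> \<xi>) z)
        = (\<integral>\<^sup>+w. averaging_kernel \<sigma> \<rho> p \<xi> z w \<partial>\<mu>)" by simp
  qed
  also have "\<dots> = (\<integral>\<^sup>+w. (\<integral>\<^sup>+z. averaging_kernel \<sigma> \<rho> p \<xi> z w \<partial>lborel) \<partial>\<mu>)"
    by (rule Fubini'[symmetric]) (rule meas)
  finally show ?thesis .
qed

end

section \<open>Lacunary series\<close>

text \<open>The maximum is attained at \<open>y = m\<close>; its additional factor exp(-m) is given
  away.\<close>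

lemma powr_mult_exp_minus_le:
  fixes y m :: real
  assumes "y > 0" "m > 0"
  shows "y powr m * exp (- y) \<le> m powr m"
proof -
  have "ln (y / m) \<le> y / m - 1" using assms by (intro ln_le_minus_one) auto
  then have "m * ln (y / m) \<le> m * (y / m - 1)" using assms by (intro mult_left_mono) auto
  then have "m * ln y - y \<le> m * ln m" using assms by (simp add: ln_div algebra_simps)
  then have "exp (m * ln y - y) \<le> exp (m * ln m)" by simp
  then show ?thesis using assms by (simp add: powr_def exp_diff exp_minus field_simps)
qed

lemma one_minus_power_le_exp:
  assumes "0 \<le> r" "r < (1::real)"
  shows "r ^ n \<le> exp (- (real n * (1 - r)))"
proof -
  have "r \<le> exp (- (1 - r))" using exp_ge_add_one_self[of "- (1 - r)"] by simp
  then have "r ^ n \<le> exp (- (1 - r)) ^ n" using assms by (intro power_mono) auto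
  then show ?thesis by (simp add: exp_of_nat_mult[symmetric] algebra_simps)
qed

lemma exp_le_one_minus_power:
  fixes x :: real
  assumes "0 \<le> x" "x \<le> 1/2" "real n * x \<le> 1"
  shows "exp (- 2) \<le> (1 - x) ^ n"
proof -
  have "- x - 2 * x\<^sup>2 \<le> ln (1 - x)" using assms by (intro ln_one_minus_pos_lower_bound) auto
  moreover have "2 * x\<^sup>2 \<le> x" using assms mult_right_mono[of x "1/2" x] by (simp add: power2_eq_square)
  ultimately have "- (2 * x) \<le> ln (1 - x)" by linarith
  then have "exp (- (2 * x)) \<le> 1 - x" using assms by (simp add: ln_ge_iff)
  then have "exp (- (2 * x)) ^ n \<le> (1 - x) ^ n" by (intro power_mono) auto
  moreover have "exp (- (2 * x)) ^ n = exp (- (2 * (real n * x)))"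
    by (simp add: exp_of_nat_mult[symmetric] mult_ac)
  moreover have "exp (- 2) \<le> exp (- (2 * (real n * x)))" using assms by simp
  ultimately show ?thesis by linarith
qed

text \<open>The offset \<open>p\<close> allows two series of the same ratio \<open>Q\<close> with
  interlacing exponents.\<close>

definition lac_exp :: "nat \<Rightarrow> nat \<Rightarrow> nat \<Rightarrow> nat" where
  "lac_exp p Q k = p * Q ^ k"

text \<open>A Hadamard gap series. The coefficient n^\<beta> of z^n makes that term of size (1 -
  |z|)^(-\<beta>) where n (1 - |z|) is of order 1.\<close>

definition lac_fun :: "real \<Rightarrow> nat \<Rightarrow> nat \<Rightarrow> complex \<Rightarrow> complex" where
  "lac_fun \<beta> p Q z = (\<Sum>k. of_real (real (lac_exp p Q k) powr \<beta>) * z ^ lac_exp p Q k)"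

lemma lac_exp_powr: "real (lac_exp p Q k) powr \<beta> = real p powr \<beta> * (real Q powr \<beta>) ^ k"
  by (cases "Q = 0"; cases k) (auto simp: lac_exp_def powr_mult powr_power powr_powr mult.commute simp flip: powr_realpow)

lemma lac_abs_bound:
  fixes \<beta> :: real
  assumes \<beta>: "\<beta> > 0" and Q: "Q \<ge> 2" and p: "p \<ge> 1"
  shows "\<exists>C>0. \<forall>r. 0 \<le> r \<longrightarrow> r < 1 \<longrightarrow>
    summable (\<lambda>k. real (lac_exp p Q k) powr \<beta> * r ^ lac_exp p Q k) \<and>
    (\<Sum>k. real (lac_exp p Q k) powr \<beta> * r ^ lac_exp p Q k) \<le> C * (1 - r) powr (- \<beta>)"
proof -
  define b where "b = real Q powr \<beta>"
  have b: "b > 1" using \<beta> Q by (simp add: b_def)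
  define M where "M = (2 * \<beta>) powr (2 * \<beta>)"
  have M: "M \<ge> 0" by (simp add: M_def)
  \<comment> \<open>For v = y^\<beta>, \<open>M\<close> bounds v^2 exp(-y). The factor 2b comes from
    (1 + v)(1 + bv) \<le> 2b (1 + v^2), and b - 1 from the increment of u/(1 + u) between v and bv,
    which is (b - 1) v / ((1 + v)(1 + bv)).\<close>
  define C where "C = 2 * b * (1 + M) / (b - 1)"
  have C: "C > 0" using b M by (simp add: C_def)
  define a where "a r k = real (lac_exp p Q k) powr \<beta> * r ^ lac_exp p Q k" for r k
  have partial: "(\<Sum>k<n. a r k) \<le> C * (1 - r) powr (- \<beta>)" if r: "0 \<le> r" "r < 1" for r n
  proof -
    define x where "x = 1 - r"
    have x: "x > 0" using r by (simp add: x_def)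
    define u where "u k = (real (lac_exp p Q k) * x) powr \<beta>" for k
    have u0: "u k > 0" for k using x p Q by (simp add: u_def lac_exp_def)
    have uS: "u (Suc k) = b * u k" for k
      using x by (simp add: u_def powr_mult lac_exp_powr b_def)
    \<comment> \<open>Each term is dominated by an increment of the bounded function \<open>u / (1 + u)\<close> along the
      geometric sequence \<open>u k\<close>, so the sum telescopes.\<close>
    have tele: "x powr \<beta> * a r k \<le> C * (u (Suc k) / (1 + u (Suc k)) - u k / (1 + u k))" for k
    proof -
      define y where "y = real (lac_exp p Q k) * x"
      have y: "y > 0" using x p Q by (simp add: y_def lac_exp_def)
      define v where "v = u k"
      have v: "v > 0" "v = y powr \<beta>" using u0[of k] by (auto simp: v_def u_def y_def)
      have "x powr \<beta> * a r k = v * r ^ lac_exp p Q k"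
        using x by (simp add: a_def v_def u_def powr_mult)
      also have "\<dots> \<le> v * exp (- y)"
        using one_minus_power_le_exp[OF r] v by (intro mult_left_mono) (auto simp: y_def x_def)
      finally have 1: "x powr \<beta> * a r k \<le> v * exp (- y)" .
      have "v\<^sup>2 = y powr (2 * \<beta>)" using y by (simp add: v power2_eq_square flip: powr_add)
      then have "v\<^sup>2 * exp (- y) \<le> M"
        unfolding M_def using powr_mult_exp_minus_le[OF y, of "2 * \<beta>"] \<beta> by simp
      moreover have "exp (- y) \<le> 1" using y by simp
      moreover have "exp (- y) * (1 + v\<^sup>2) = exp (- y) + v\<^sup>2 * exp (- y)"
        by (simp add: algebra_simps)
      ultimately have 2: "exp (- y) * (1 + v\<^sup>2) \<le> 1 + M" by linarith
      have "(1 + v) * (1 + b * v) \<le> (1 + v) * (b * (1 + v))"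
        using b v by (intro mult_left_mono) (auto simp: algebra_simps)
      also have "\<dots> = b * (1 + v)\<^sup>2" by (simp add: power2_eq_square)
      also have "\<dots> \<le> b * (2 * (1 + v\<^sup>2))"
        using b sum_squares_ge_zero[of "1 - v" 0]
        by (intro mult_left_mono) (auto simp: power2_eq_square algebra_simps)
      finally have "exp (- y) * ((1 + v) * (1 + b * v)) \<le> exp (- y) * (b * (2 * (1 + v\<^sup>2)))"
        by (intro mult_left_mono) auto
      also have "\<dots> = 2 * b * (exp (- y) * (1 + v\<^sup>2))" by simp
      also have "\<dots> \<le> 2 * b * (1 + M)" using 2 b by (intro mult_left_mono) auto
      also have "\<dots> = C * (b - 1)" using b by (simp add: C_def)
      finally have "exp (- y) \<le> C * (b - 1) / ((1 + v) * (1 + b * v))"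
        using b v by (simp add: pos_le_divide_eq add_pos_pos)
      then have "v * exp (- y) \<le> v * (C * (b - 1) / ((1 + v) * (1 + b * v)))"
        using v by (intro mult_left_mono) auto
      also have "\<dots> = C * (((b * v) * (1 + v) - v * (1 + b * v)) / ((1 + b * v) * (1 + v)))"
        by (simp add: algebra_simps)
      also have "((b * v) * (1 + v) - v * (1 + b * v)) / ((1 + b * v) * (1 + v)) = b * v / (1 + b * v) - v / (1 + v)"
        using b v by (intro diff_frac_eq[symmetric]) (auto simp: add_nonneg_eq_0_iff)
      finally show ?thesis using 1 by (simp add: uS v_def)
    qed
    have "x powr \<beta> * (\<Sum>k<n. a r k) = (\<Sum>k<n. x powr \<beta> * a r k)"
      by (simp add: sum_distrib_left)
    also have "\<dots> \<le> (\<Sum>k<n. C * (u (Suc k) / (1 + u (Suc k)) - u k / (1 + u k)))"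
      by (intro sum_mono tele)
    also have "\<dots> = C * (u n / (1 + u n) - u 0 / (1 + u 0))"
      by (simp only: sum_distrib_left[symmetric] sum_lessThan_telescope[of "\<lambda>k. u k / (1 + u k)"])
    also have "\<dots> \<le> C * 1"
    proof (rule mult_left_mono)
      have "u n / (1 + u n) \<le> 1" "u 0 / (1 + u 0) \<ge> 0"
        using u0[of n] u0[of 0] by auto
      then show "u n / (1 + u n) - u 0 / (1 + u 0) \<le> 1" by linarith
    qed (use C in simp)
    finally show ?thesis
      using x by (simp add: x_def powr_minus field_simps)
  qed
  have a0: "a r k \<ge> 0" if "0 \<le> r" for r k using that by (simp add: a_def)
  have "summable (a r) \<and> suminf (a r) \<le> C * (1 - r) powr (- \<beta>)" if r: "0 \<le> r" "r < 1" for r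
  proof
    show s: "summable (a r)"
      using a0[OF r(1)] partial[OF r] by (rule summableI_nonneg_bounded)
    show "suminf (a r) \<le> C * (1 - r) powr (- \<beta>)"
      by (intro suminf_le_const s partial[OF r])
  qed
  then show ?thesis
    using C unfolding a_def[abs_def] by blast
qed

lemma lac_fun_holomorphic:
  assumes "\<beta> > 0" "Q \<ge> 2" "p \<ge> 1"
  shows "lac_fun \<beta> p Q holomorphic_on unit_disk"
proof -
  have sm: "summable (\<lambda>k. real (lac_exp p Q k) powr \<beta> * r ^ lac_exp p Q k)" if "0 \<le> r" "r < 1" for r
    using lac_abs_bound[OF assms] that by blast
  define f where "f k z = of_real (real (lac_exp p Q k) powr \<beta>) * z ^ lac_exp p Q k" for k and z :: complex
  define f' where "f' k z = of_real (real (lac_exp p Q k) powr \<beta>) * (of_nat (lac_exp p Q k) * z ^ (lac_exp p Q k - 1))"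
    for k and z :: complex
  have "\<exists>g g'. \<forall>x \<in> unit_disk. ((\<lambda>n. f n x) sums g x) \<and> ((\<lambda>n. f' n x) sums g' x) \<and> (g has_field_derivative g' x) (at x)"
  proof (rule series_and_derivative_comparison_local)
    show "open unit_disk" by (simp add: unit_disk_def)
    show "(f n has_field_derivative f' n x) (at x)" for n x
      unfolding f_def[abs_def] f'_def by (auto intro!: derivative_eq_intros)
    fix x assume "x \<in> unit_disk"
    then have x: "cmod x < 1" by (simp add: unit_disk_def)
    define r where "r = (1 + cmod x) / 2"
    have r: "0 \<le> r" "r < 1" using x by (auto simp: r_def add_nonneg_nonneg)
    have "norm (f n y) \<le> real (lac_exp p Q n) powr \<beta> * r ^ lac_exp p Q n"
      if "y \<in> ball x ((1 - cmod x) / 2)" for n y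
    proof -
      have "cmod (x - y) < (1 - cmod x) / 2" using that by (simp add: dist_norm)
      then have "cmod y \<le> r"
        using norm_triangle_ineq2[of y x] by (simp add: r_def norm_minus_commute field_simps)
      then have "cmod y ^ lac_exp p Q n \<le> r ^ lac_exp p Q n" by (intro power_mono) auto
      then show ?thesis by (simp add: f_def norm_mult norm_power mult_left_mono)
    qed
    then show "\<exists>d h. 0 < d \<and> summable h \<and> (\<forall>\<^sub>F n in sequentially. \<forall>y\<in>ball x d \<inter> unit_disk. norm (f n y) \<le> h n)"
      using x sm[OF r]
      by (intro exI[of _ "(1 - cmod x) / 2"] exI[of _ "\<lambda>n. real (lac_exp p Q n) powr \<beta> * r ^ lac_exp p Q n"])
         (auto intro!: always_eventually)
  qed
  then obtain g g' where g: "\<And>x. x \<in> unit_disk \<Longrightarrow> (\<lambda>n. f n x) sums g x"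
      "\<And>x. x \<in> unit_disk \<Longrightarrow> (g has_field_derivative g' x) (at x)"
    by blast
  have "g holomorphic_on unit_disk"
    using g(2) by (auto simp: holomorphic_on_def field_differentiable_def intro: has_field_derivative_at_within)
  moreover have "lac_fun \<beta> p Q z = g z" if "z \<in> unit_disk" for z
    using sums_unique[OF g(1)[OF that]] by (simp add: lac_fun_def f_def)
  ultimately show ?thesis by (simp cong: holomorphic_cong)
qed

text \<open>Where n_k x lies between 1/\<nu> and 1, the k-th term has size at least exp(-2)
  n_k^\<beta>. The earlier terms form a geometric sum and the later ones decay exponentially;
  \<open>large\<close> keeps both together below half of the main term. The ratio is
  \<open>\<nu>\<^sup>2\<close> while the window has width only \<open>\<nu>\<close>: then n_{k+1} x
  is at least \<nu>. With windows as wide as the ratio it could be as small as 1, and the next term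
  would compete.\<close>

lemma lac_fun_lower_bound:
  fixes \<beta> :: real and \<nu> :: nat
  assumes \<beta>: "\<beta> > 0" and \<nu>: "\<nu> \<ge> 2" and p: "p \<ge> 1"
    and large: "2 * exp 2 * (1 + (4 * \<beta>) powr (4 * \<beta>)) \<le> (real \<nu> powr \<beta>)\<^sup>2 - 1"
    and z: "cmod z < 1" "1 - cmod z \<le> 1/2"
    and k: "real (lac_exp p (\<nu>\<^sup>2) k) * (1 - cmod z) \<le> 1"
      "1 \<le> real \<nu> * (real (lac_exp p (\<nu>\<^sup>2) k) * (1 - cmod z))"
  shows "exp (- 2) / 2 * real (lac_exp p (\<nu>\<^sup>2) k) powr \<beta> \<le> cmod (lac_fun \<beta> p (\<nu>\<^sup>2) z)"
proof -
  define n where "n = lac_exp p (\<nu>\<^sup>2)"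
  define x where "x = 1 - cmod z"
  have x: "0 < x" "x \<le> 1/2" using z by (auto simp: x_def)
  define g where "g = real \<nu> powr \<beta>"
  have g: "g > 1" using \<beta> \<nu> by (simp add: g_def)
  define b where "b = g\<^sup>2"
  have b: "b > 1" using g by (simp add: b_def)
  have bQ: "real (\<nu>\<^sup>2) powr \<beta> = b"
    using \<nu> by (simp add: b_def g_def power2_eq_square powr_mult)
  define A where "A = real (n k) powr \<beta>"
  have A: "A > 0" using p \<nu> by (simp add: A_def n_def lac_exp_def)
  have nb: "real (n j) powr \<beta> = real p powr \<beta> * b ^ j" for j
    unfolding n_def lac_exp_powr bQ ..
  define M where "M = (4 * \<beta>) powr (4 * \<beta>)"
  have M: "M \<ge> 0" by (simp add: M_def)
  define c where "c j = of_real (real (n j) powr \<beta>) * z ^ n j" for j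
  have \<nu>2: "\<nu>\<^sup>2 \<ge> 2"
    using mult_le_mono[OF \<nu> \<nu>] by (simp add: power2_eq_square)
  have "summable (\<lambda>j. real (lac_exp p (\<nu>\<^sup>2) j) powr \<beta> * cmod z ^ lac_exp p (\<nu>\<^sup>2) j)"
    using lac_abs_bound[OF \<beta> \<nu>2 p] z(1) norm_ge_zero[of z] by blast
  moreover have nc: "cmod (c j) = real (n j) powr \<beta> * cmod z ^ n j" for j
    by (simp add: c_def norm_mult norm_power)
  ultimately have sm: "summable (\<lambda>j. cmod (c j))" by (simp add: n_def)
  have smc: "summable c" using sm by (rule summable_norm_cancel)
  have head: "cmod (\<Sum>j<k. c j) \<le> A / (b - 1)"
  proof -
    have "cmod (\<Sum>j<k. c j) \<le> (\<Sum>j<k. real p powr \<beta> * b ^ j)"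
    proof (rule order_trans[OF norm_sum], rule sum_mono)
      fix j
      have "cmod z ^ n j \<le> 1" using z by (intro power_le_one) auto
      then show "cmod (c j) \<le> real p powr \<beta> * b ^ j"
        using b by (simp add: nc nb mult_left_le)
    qed
    also have "\<dots> = real p powr \<beta> * ((b ^ k - 1) / (b - 1))"
      using b by (simp add: sum_distrib_left[symmetric] geometric_sum)
    also have "\<dots> \<le> real p powr \<beta> * (b ^ k / (b - 1))"
      using b by (intro mult_left_mono divide_right_mono) auto
    also have "\<dots> = A / (b - 1)" by (simp add: A_def nb)
    finally show ?thesis .
  qed
  have tail_summand: "cmod (c (j + Suc k)) \<le> A * M * (1 / b) ^ Suc j" for j
  proof -
    \<comment> \<open>The (j+1)-st exponent after n_k is n_k \<nu>^(2j+2); one factor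
      \<open>\<nu>\<close> is spent on lifting n_k x to 1, so its product with \<open>x\<close> is
      still at least \<open>Y\<close>.\<close>
    define Y where "Y = real \<nu> ^ (2 * j + 1)"
    have Y: "Y > 0" using \<nu> by (simp add: Y_def)
    have "real (n (j + Suc k)) = real (n k) * real \<nu> ^ (2 * j + 2)"
      by (simp add: n_def lac_exp_def power_add power_mult power2_eq_square)
    then have "real (n (j + Suc k)) * x = Y * (real \<nu> * (real (n k) * x))"
      by (simp add: Y_def)
    moreover have "Y * 1 \<le> Y * (real \<nu> * (real (n k) * x))"
      using k(2) Y by (intro mult_left_mono) (auto simp: n_def x_def)
    ultimately have nY: "Y \<le> real (n (j + Suc k)) * x" by linarith
    have "cmod z ^ n (j + Suc k) \<le> exp (- (real (n (j + Suc k)) * x))"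
      using one_minus_power_le_exp[of "cmod z"] z by (simp add: x_def)
    also have "\<dots> \<le> exp (- Y)" using nY by simp
    \<comment> \<open>The power 4\<beta> is large enough to beat the coefficients:
      \<open>Y powr (4 * \<beta>)\<close> is at least b^(2(j+1)), while they grow like
      b^(j+1).\<close>
    also have "\<dots> \<le> M / Y powr (4 * \<beta>)"
      using powr_mult_exp_minus_le[OF Y, of "4 * \<beta>"] \<beta> Y by (simp add: M_def field_simps)
    also have "Y powr (4 * \<beta>) = g ^ (4 * (2 * j + 1))"
    proof -
      have "Y powr (4 * \<beta>) = real \<nu> powr (real (2 * j + 1) * (4 * \<beta>))"
      proof -
        have "Y = real \<nu> powr real (2 * j + 1)"
          unfolding Y_def using \<nu> by (intro powr_realpow[symmetric]) auto
        then show ?thesis by (simp only: powr_powr)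
      qed
      also have "real (2 * j + 1) * (4 * \<beta>) = \<beta> * real (4 * (2 * j + 1))" by simp
      also have "real \<nu> powr (\<beta> * real (4 * (2 * j + 1))) = g powr real (4 * (2 * j + 1))"
        by (simp add: g_def powr_powr)
      also have "\<dots> = g ^ (4 * (2 * j + 1))" using g by (intro powr_realpow) auto
      finally show ?thesis .
    qed
    finally have e: "cmod z ^ n (j + Suc k) \<le> M / g ^ (4 * (2 * j + 1))" .
    have "cmod (c (j + Suc k)) = A * b ^ Suc j * cmod z ^ n (j + Suc k)"
      by (simp add: nc nb A_def power_add mult_ac)
    also have "\<dots> \<le> A * b ^ Suc j * (M / g ^ (4 * (2 * j + 1)))"
      using e A b by (intro mult_left_mono) auto
    also have "\<dots> \<le> A * b ^ Suc j * (M / b ^ (2 * Suc j))"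
    proof -
      have "b ^ (2 * Suc j) = g ^ (4 * Suc j)" by (simp add: b_def power_add flip: power_mult)
      also have "\<dots> \<le> g ^ (4 * (2 * j + 1))" using g by (intro power_increasing) auto
      finally show ?thesis
        using A b M g by (intro mult_left_mono divide_left_mono) auto
    qed
    also have "\<dots> = A * M * (1 / b) ^ Suc j"
      using b by (simp add: power_mult power2_eq_square power_one_over field_simps power_mult_distrib)
    finally show ?thesis .
  qed
  have geo: "(\<lambda>j. A * M * (1 / b) ^ Suc j) sums (A * M * (1 / b * (1 / (1 - 1 / b))))"
    using b unfolding power_Suc by (intro sums_mult geometric_sums) auto
  have geo_eq: "A * M * (1 / b * (1 / (1 - 1 / b))) = A * M / (b - 1)"
    using b by (simp add: field_simps)
  have smt: "summable (\<lambda>j. cmod (c (j + Suc k)))"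
    using sm by (subst summable_iff_shift)
  have tail: "cmod (\<Sum>j. c (j + Suc k)) \<le> A * M / (b - 1)"
  proof -
    have "cmod (\<Sum>j. c (j + Suc k)) \<le> (\<Sum>j. cmod (c (j + Suc k)))"
      by (rule summable_norm[OF smt])
    also have "\<dots> \<le> (\<Sum>j. A * M * (1 / b) ^ Suc j)"
      using geo by (intro suminf_le tail_summand smt) (rule sums_summable)
    also have "\<dots> = A * M / (b - 1)"
      using sums_unique[OF geo] geo_eq by simp
    finally show ?thesis .
  qed
  have main: "A * exp (- 2) \<le> cmod (c k)"
    using exp_le_one_minus_power[of x "n k"] x k(1) A
    by (simp add: nc A_def x_def n_def mult_left_mono)
  have "lac_fun \<beta> p (\<nu>\<^sup>2) z = (\<Sum>j. c j)"
    by (simp add: lac_fun_def c_def n_def)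
  also have "\<dots> = (\<Sum>j. c (j + Suc k)) + (\<Sum>j<Suc k. c j)"
    by (rule suminf_split_initial_segment[OF smc])
  also have "\<dots> = c k + ((\<Sum>j. c (j + Suc k)) + (\<Sum>j<k. c j))"
    by simp
  finally have eq: "lac_fun \<beta> p (\<nu>\<^sup>2) z = c k + ((\<Sum>j. c (j + Suc k)) + (\<Sum>j<k. c j))" .
  have "cmod ((\<Sum>j. c (j + Suc k)) + (\<Sum>j<k. c j)) \<le> A * M / (b - 1) + A / (b - 1)"
    using norm_triangle_ineq[of "\<Sum>j. c (j + Suc k)" "\<Sum>j<k. c j"] head tail by linarith
  moreover have "cmod (c k) - cmod ((\<Sum>j. c (j + Suc k)) + (\<Sum>j<k. c j)) \<le> cmod (lac_fun \<beta> p (\<nu>\<^sup>2) z)"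
    unfolding eq by (rule norm_diff_ineq)
  moreover have "A * M / (b - 1) + A / (b - 1) \<le> A * (exp (- 2) / 2)"
  proof -
    have "2 * exp 2 * (1 + M) \<le> b - 1" using large by (simp add: M_def b_def g_def)
    then have "(1 + M) / (b - 1) \<le> exp (- 2) / 2"
      using b by (simp add: exp_minus field_simps)
    then have "A * ((1 + M) / (b - 1)) \<le> A * (exp (- 2) / 2)" using A by (intro mult_left_mono) auto
    moreover have "A * M / (b - 1) + A / (b - 1) = A * ((1 + M) / (b - 1))"
      by (simp add: add_divide_distrib distrib_left)
    ultimately show ?thesis by simp
  qed
  ultimately have "A * exp (- 2) - A * (exp (- 2) / 2) \<le> cmod (lac_fun \<beta> p (\<nu>\<^sup>2) z)"
    using main by linarith
  then show ?thesis by (simp add: A_def n_def mult.commute)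
qed

text \<open>The exponents of \<open>f1\<close> are the even powers of \<open>\<nu>\<close>, those of
  \<open>f2\<close> the odd ones. Each x = 1 - |z| \<le> 1/2 has an \<open>l\<close> with \<nu>^l x
  \<le> 1 < \<nu>^(l+1) x, and the parity of \<open>l\<close> tells which series is large at
  \<open>z\<close>. The summand 1 covers |z| < 1/2.\<close>

lemma growth_space_test_functions:
  fixes \<beta> :: real
  assumes \<beta>: "\<beta> > 0"
  obtains f1 f2 :: "complex \<Rightarrow> complex" and C c :: real
  where "f1 holomorphic_on unit_disk" "f2 holomorphic_on unit_disk" "C > 0" "c > 0"
    "\<And>z. z \<in> unit_disk \<Longrightarrow> cmod (f1 z) * (1 - cmod z) powr \<beta> \<le> C"
    "\<And>z. z \<in> unit_disk \<Longrightarrow> cmod (f2 z) * (1 - cmod z) powr \<beta> \<le> C"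
    "\<And>z. z \<in> unit_disk \<Longrightarrow> (1 - cmod z) powr (- \<beta>) \<le> c * (cmod (f1 z) + cmod (f2 z) + 1)"
proof -
  define L where "L = 2 * exp 2 * (1 + (4 * \<beta>) powr (4 * \<beta>)) + 1"
  have L: "L \<ge> 1" by (simp add: L_def)
  obtain m :: nat where m: "L powr (1 / \<beta>) \<le> real m" using real_arch_simple by blast
  define \<nu> where "\<nu> = max m 2"
  have \<nu>: "\<nu> \<ge> 2" by (simp add: \<nu>_def)
  have "L = (L powr (1 / \<beta>)) powr \<beta>" using L \<beta> by (simp add: powr_powr)
  also have "\<dots> \<le> real \<nu> powr \<beta>" using m \<beta> by (intro powr_mono2) (auto simp: \<nu>_def)
  finally have "L \<le> real \<nu> powr \<beta>" .
  also have "\<dots> \<le> (real \<nu> powr \<beta>)\<^sup>2"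
    using \<nu> \<beta> by (intro self_le_power) (auto simp: ge_one_powr_ge_zero)
  finally have large: "2 * exp 2 * (1 + (4 * \<beta>) powr (4 * \<beta>)) \<le> (real \<nu> powr \<beta>)\<^sup>2 - 1"
    by (simp add: L_def)
  have \<nu>2: "\<nu>\<^sup>2 \<ge> 2"
    using mult_le_mono[OF \<nu> \<nu>] by (simp add: power2_eq_square)
  have upper: "\<exists>C>0. \<forall>z\<in>unit_disk. cmod (lac_fun \<beta> p (\<nu>\<^sup>2) z) * (1 - cmod z) powr \<beta> \<le> C" if p: "p \<ge> 1" for p
  proof -
    obtain C where C: "C > 0" and bound: "\<forall>r. 0 \<le> r \<longrightarrow> r < 1 \<longrightarrow>
        summable (\<lambda>k. real (lac_exp p (\<nu>\<^sup>2) k) powr \<beta> * r ^ lac_exp p (\<nu>\<^sup>2) k) \<and>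
        (\<Sum>k. real (lac_exp p (\<nu>\<^sup>2) k) powr \<beta> * r ^ lac_exp p (\<nu>\<^sup>2) k) \<le> C * (1 - r) powr (- \<beta>)"
      using lac_abs_bound[OF \<beta> \<nu>2 p] by blast
    have "cmod (lac_fun \<beta> p (\<nu>\<^sup>2) z) * (1 - cmod z) powr \<beta> \<le> C" if "z \<in> unit_disk" for z
    proof -
      have z: "cmod z < 1" using that by (simp add: unit_disk_def)
      have "summable (\<lambda>k. cmod (of_real (real (lac_exp p (\<nu>\<^sup>2) k) powr \<beta>) * z ^ lac_exp p (\<nu>\<^sup>2) k))"
        using bound[rule_format, of "cmod z"] z by (simp add: norm_mult norm_power)
      from summable_norm[OF this]
      have "cmod (lac_fun \<beta> p (\<nu>\<^sup>2) z) \<le> C * (1 - cmod z) powr (- \<beta>)"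
        using bound[rule_format, of "cmod z"] z by (simp add: lac_fun_def norm_mult norm_power)
      then show ?thesis using z by (simp add: powr_minus field_simps)
    qed
    then show ?thesis using C by blast
  qed
  define f1 where "f1 = lac_fun \<beta> 1 (\<nu>\<^sup>2)"
  define f2 where "f2 = lac_fun \<beta> \<nu> (\<nu>\<^sup>2)"
  obtain C1 where C1: "C1 > 0" "\<And>z. z \<in> unit_disk \<Longrightarrow> cmod (f1 z) * (1 - cmod z) powr \<beta> \<le> C1"
    using upper[of 1] by (auto simp: f1_def)
  obtain C2 where C2: "C2 > 0" "\<And>z. z \<in> unit_disk \<Longrightarrow> cmod (f2 z) * (1 - cmod z) powr \<beta> \<le> C2"
    using upper[of \<nu>] \<nu> by (auto simp: f2_def)
  \<comment> \<open>The factor 2 exp 2 inverts the constant of \<open>lac_fun_lower_bound\<close>;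
    \<open>\<nu> powr \<beta>\<close> pays for 1/x being as large as \<nu>^(l+1) rather than
    \<nu>^l.\<close>
  define d where "d = 2 * exp 2 * real \<nu> powr \<beta>"
  have d: "d > 0" using \<nu> by (simp add: d_def)
  have lower: "(1 - cmod z) powr (- \<beta>) \<le> d * (cmod (f1 z) + cmod (f2 z))"
    if z: "cmod z < 1" "1 - cmod z \<le> 1/2" for z
  proof -
    define x where "x = 1 - cmod z"
    have x: "0 < x" "x \<le> 1/2" using z by (auto simp: x_def)
    \<comment> \<open>With \<open>Suc l\<close> in the condition, minimality gives \<nu>^l \<le> 1/x
      for positive \<open>l\<close>, and for \<open>l = 0\<close> this holds because x < 1.\<close>
    define l where "l = (LEAST l. 1 / x < real \<nu> ^ Suc l)"
    have "\<exists>l. 1 / x < real \<nu> ^ l" using \<nu> by (intro real_arch_pow) auto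
    then obtain l0 where l0: "1 / x < real \<nu> ^ l0" ..
    also have "\<dots> \<le> real \<nu> ^ Suc l0" using \<nu> by (intro power_increasing) auto
    finally have l1: "1 / x < real \<nu> ^ Suc l"
      unfolding l_def by (rule LeastI)
    have l2: "real \<nu> ^ l \<le> 1 / x"
    proof (cases l)
      case 0
      then show ?thesis using x by simp
    next
      case (Suc i)
      then have "\<not> 1 / x < real \<nu> ^ Suc i"
        using not_less_Least[of i "\<lambda>l. 1 / x < real \<nu> ^ Suc l", folded l_def] by blast
      then show ?thesis using Suc by simp
    qed
    have key: "(1 - cmod z) powr (- \<beta>) \<le> d * cmod (lac_fun \<beta> p (\<nu>\<^sup>2) z)"
      if p: "p \<ge> 1" and pk: "real (lac_exp p (\<nu>\<^sup>2) k) = real \<nu> ^ l" for p k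
    proof -
      have "real \<nu> ^ l * x \<le> 1" using l2 x by (simp add: field_simps)
      moreover have nx: "1 \<le> real \<nu> * (real \<nu> ^ l * x)" using l1 x by (simp add: field_simps)
      ultimately have "exp (- 2) / 2 * real (lac_exp p (\<nu>\<^sup>2) k) powr \<beta> \<le> cmod (lac_fun \<beta> p (\<nu>\<^sup>2) z)"
        using lac_fun_lower_bound[OF \<beta> \<nu> p large z, of k] by (simp add: pk x_def)
      then have "(real \<nu> ^ l) powr \<beta> \<le> 2 * exp 2 * cmod (lac_fun \<beta> p (\<nu>\<^sup>2) z)"
        by (simp add: pk exp_minus field_simps)
      then have "real \<nu> powr \<beta> * (real \<nu> ^ l) powr \<beta> \<le> real \<nu> powr \<beta> * (2 * exp 2 * cmod (lac_fun \<beta> p (\<nu>\<^sup>2) z))"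
        by (intro mult_left_mono) auto
      moreover have "x powr (- \<beta>) \<le> real \<nu> powr \<beta> * (real \<nu> ^ l) powr \<beta>"
      proof -
        have "1 / x \<le> real \<nu> * real \<nu> ^ l" using l1 by simp
        then have "(1 / x) powr \<beta> \<le> (real \<nu> * real \<nu> ^ l) powr \<beta>"
          using x \<beta> by (intro powr_mono2) auto
        then show ?thesis using x by (simp add: powr_divide powr_minus powr_mult inverse_eq_divide)
      qed
      ultimately show ?thesis by (simp add: d_def x_def mult_ac)
    qed
    show ?thesis
    proof (cases "even l")
      case True
      then obtain k where "l = 2 * k" by (elim evenE)
      then have "real (lac_exp 1 (\<nu>\<^sup>2) k) = real \<nu> ^ l" by (simp add: lac_exp_def power_mult)
      from key[OF _ this] have "(1 - cmod z) powr (- \<beta>) \<le> d * cmod (f1 z)" by (simp add: f1_def)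
      also have "\<dots> \<le> d * (cmod (f1 z) + cmod (f2 z))" using d by simp
      finally show ?thesis .
    next
      case False
      then obtain k where "l = 2 * k + 1" by (elim oddE)
      then have "real (lac_exp \<nu> (\<nu>\<^sup>2) k) = real \<nu> ^ l" by (simp add: lac_exp_def power_mult)
      from key[OF _ this] \<nu> have "(1 - cmod z) powr (- \<beta>) \<le> d * cmod (f2 z)" by (simp add: f2_def)
      also have "\<dots> \<le> d * (cmod (f1 z) + cmod (f2 z))" using d by simp
      finally show ?thesis .
    qed
  qed
  \<comment> \<open>The summand \<open>d\<close> serves near the boundary,
    \<open>2 powr \<beta>\<close> bounds the weight where 1 - |z| > 1/2.\<close>
  define c where "c = d + 2 powr \<beta>"
  have c: "c > 0" using d by (simp add: c_def add_pos_pos)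
  show thesis
  proof (rule that[of f1 f2 "max C1 C2" c])
    show "f1 holomorphic_on unit_disk" "f2 holomorphic_on unit_disk"
      unfolding f1_def f2_def using \<nu> by (auto intro!: lac_fun_holomorphic \<beta> \<nu>2)
    show "max C1 C2 > 0" "c > 0" using C1 c by auto
    fix z assume zD: "z \<in> unit_disk"
    show "cmod (f1 z) * (1 - cmod z) powr \<beta> \<le> max C1 C2" "cmod (f2 z) * (1 - cmod z) powr \<beta> \<le> max C1 C2"
      using C1(2)[OF zD] C2(2)[OF zD] by auto
    have z: "cmod z < 1" using zD by (simp add: unit_disk_def)
    define S where "S = cmod (f1 z) + cmod (f2 z)"
    have S: "S \<ge> 0" by (simp add: S_def)
    have "(1 - cmod z) powr (- \<beta>) \<le> c * (S + 1)"
    proof (cases "1 - cmod z \<le> 1/2")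
      case True
      have "(1 - cmod z) powr (- \<beta>) \<le> d * S" using lower[OF z True] by (simp add: S_def)
      also have "\<dots> \<le> c * (S + 1)" using d S by (intro mult_mono) (auto simp: c_def)
      finally show ?thesis .
    next
      case False
      then have "(1 - cmod z) powr (- \<beta>) \<le> (1/2) powr (- \<beta>)"
        using \<beta> by (intro powr_mono2') auto
      also have "\<dots> = 2 powr \<beta>" by (simp add: powr_minus powr_divide)
      also have "\<dots> \<le> c * 1" using d by (simp add: c_def)
      also have "\<dots> \<le> c * (S + 1)" using S c by (intro mult_left_mono) auto
      finally show ?thesis .
    qed
    then show "(1 - cmod z) powr (- \<beta>) \<le> c * (cmod (f1 z) + cmod (f2 z) + 1)" by (simp add: S_def)
  qed
qed

section \<open>The two equivalences\<close>

context disk_measure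
begin

lemma sigma_finite_if_weak_bounded_cone_integral:
  assumes \<sigma>: "\<sigma> > 1" and q: "q > 0"
    and bd: "weak_bounded q N (\<lambda>\<xi>. \<integral>\<^sup>+z\<in>lusin_cone \<sigma> \<xi>. ennreal ((1 - cmod z) powr s) \<partial>\<mu>)"
  shows "sigma_finite_measure \<mu>"
proof (rule sigma_finite_if_weak_bounded[OF \<sigma> zero_less_one q _ bd])
  show "(\<lambda>\<xi>. \<integral>\<^sup>+z\<in>lusin_cone \<sigma> \<xi>. ennreal ((1 - cmod z) powr s) \<partial>\<mu>) \<in> borel_measurable borel"
    by (intro cone_integral_measurable borel_measurable_disk weight_measurable)
  fix z0 \<delta> \<xi>
  assume \<delta>: "\<delta> > 0" and z0: "cmod z0 < 1"
    and near: "\<And>z. z \<in> ball z0 \<delta> \<Longrightarrow> cmod z < 1 \<and> 1 - cmod z \<le> 2 * (1 - cmod z0) \<and> 1 - cmod z0 \<le> 2 * (1 - cmod z)"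
    and cone: "ball z0 \<delta> \<subseteq> lusin_cone \<sigma> \<xi>" and inf: "emeasure \<mu> (ball z0 \<delta>) = \<infinity>"
  define \<kappa> where "\<kappa> = (1 - cmod z0) powr s / 2 powr \<bar>s\<bar>"
  have \<kappa>: "\<kappa> > 0" using z0 by (simp add: \<kappa>_def)
  have "ball z0 \<delta> \<in> sets \<mu>"
    using near by (intro sets_disk_measureI) (auto simp: unit_disk_def)
  then have "(\<integral>\<^sup>+z. ennreal \<kappa> * indicator (ball z0 \<delta>) z \<partial>\<mu>) = \<infinity>"
    using inf \<kappa> by (simp add: nn_integral_cmult_indicator ennreal_mult_top)
  moreover have "(\<integral>\<^sup>+z. ennreal \<kappa> * indicator (ball z0 \<delta>) z \<partial>\<mu>)
      \<le> (\<integral>\<^sup>+z\<in>lusin_cone \<sigma> \<xi>. ennreal ((1 - cmod z) powr s) \<partial>\<mu>)"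
  proof (rule nn_integral_mono)
    fix z
    show "ennreal \<kappa> * indicator (ball z0 \<delta>) z \<le> ennreal ((1 - cmod z) powr s) * indicator (lusin_cone \<sigma> \<xi>) z"
    proof (cases "z \<in> ball z0 \<delta>")
      case True
      have "(1 - cmod z0) powr s \<le> 2 powr \<bar>s\<bar> * (1 - cmod z) powr s"
        using near[OF True] z0 by (intro powr_comparable) auto
      then have "\<kappa> \<le> (1 - cmod z) powr s" by (simp add: \<kappa>_def field_simps)
      then show ?thesis using True cone by (auto simp: ennreal_leI)
    qed simp
  qed
  ultimately show "(\<integral>\<^sup>+z\<in>lusin_cone \<sigma> \<xi>. ennreal ((1 - cmod z) powr s) \<partial>\<mu>) = \<infinity>"
    by (simp add: top_unique)
qed

text \<open>If a small ball has infinite mass, so has the pseudohyperbolic disk about each of its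
  points, and the integrand is infinite on a set of positive area.\<close>

lemma sigma_finite_if_weak_bounded_averaged:
  assumes \<sigma>: "\<sigma> > 1" and \<rho>: "\<rho> > 0" and q: "q > 0"
    and bd: "weak_bounded q N (\<lambda>\<xi>. \<integral>\<^sup>+z\<in>lusin_cone \<sigma> \<xi>.
        ennreal ((1 - cmod z) powr p) * emeasure \<mu> (pseudo_disk \<rho> z) \<partial>area_measure)"
  shows "sigma_finite_measure \<mu>"
proof (rule sigma_finite_if_weak_bounded[OF \<sigma> \<rho> q averaged_cone_integral_measurable bd])
  fix z0 \<delta> \<xi>
  assume \<delta>: "\<delta> > 0" and z0: "cmod z0 < 1"
    and near: "\<And>z. z \<in> ball z0 \<delta> \<Longrightarrow> cmod z < 1 \<and> 1 - cmod z \<le> 2 * (1 - cmod z0) \<and> 1 - cmod z0 \<le> 2 * (1 - cmod z)"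
    and cone: "ball z0 \<delta> \<subseteq> lusin_cone \<sigma> \<xi>"
    and ps: "\<And>z. z \<in> ball z0 \<delta> \<Longrightarrow> ball z0 \<delta> \<subseteq> pseudo_disk \<rho> z"
    and inf: "emeasure \<mu> (ball z0 \<delta>) = \<infinity>"
  have [measurable]: "unit_disk \<in> sets borel" by (simp add: unit_disk_def)
  have "emeasure area_measure (ball z0 \<delta>) = (\<integral>\<^sup>+z. ennreal (indicator unit_disk z / pi) * indicator (ball z0 \<delta>) z \<partial>lborel)"
    unfolding area_measure_def by (rule emeasure_density) measurable
  also have "\<dots> = (\<integral>\<^sup>+z. ennreal (1 / pi) * indicator (ball z0 \<delta>) z \<partial>lborel)"
    using near by (intro nn_integral_cong) (auto simp: indicator_def unit_disk_def)
  also have "\<dots> = ennreal (1 / pi) * ennreal (pi * \<delta>\<^sup>2)"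
    using \<delta> by (simp add: nn_integral_cmult_indicator emeasure_lborel_complex_ball)
  also have "\<dots> > 0" using \<delta> by (simp flip: ennreal_mult)
  finally have "emeasure area_measure (ball z0 \<delta>) \<noteq> 0" by simp
  then have "(\<integral>\<^sup>+z. \<infinity> * indicator (ball z0 \<delta>) z \<partial>area_measure) = \<infinity>"
    by (subst nn_integral_cmult_indicator) (auto simp: ennreal_top_mult)
  moreover have "(\<integral>\<^sup>+z. \<infinity> * indicator (ball z0 \<delta>) z \<partial>area_measure)
      \<le> (\<integral>\<^sup>+z\<in>lusin_cone \<sigma> \<xi>. ennreal ((1 - cmod z) powr p) * emeasure \<mu> (pseudo_disk \<rho> z) \<partial>area_measure)"
  proof (rule nn_integral_mono)
    fix z
    show "\<infinity> * indicator (ball z0 \<delta>) z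
        \<le> ennreal ((1 - cmod z) powr p) * emeasure \<mu> (pseudo_disk \<rho> z) * indicator (lusin_cone \<sigma> \<xi>) z"
    proof (cases "z \<in> ball z0 \<delta>")
      case True
      have "emeasure \<mu> (ball z0 \<delta>) \<le> emeasure \<mu> (pseudo_disk \<rho> z)"
        using ps[OF True] by (intro emeasure_mono) auto
      then have "emeasure \<mu> (pseudo_disk \<rho> z) = \<infinity>" using inf by (simp add: top_unique)
      moreover have "(1 - cmod z) powr p > 0" using near[OF True] by simp
      ultimately show ?thesis using True cone by (auto simp: ennreal_mult_top)
    qed simp
  qed
  ultimately show "(\<integral>\<^sup>+z\<in>lusin_cone \<sigma> \<xi>. ennreal ((1 - cmod z) powr p) * emeasure \<mu> (pseudo_disk \<rho> z) \<partial>area_measure) = \<infinity>"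
    by (simp add: top_unique)
qed

text \<open>The averaged integral at aperture \<open>\<sigma>\<close> lies, up to constants, between
  cone integrals at a narrower and a wider aperture. The change of aperture brings both back to
  \<open>\<sigma>\<close>, once the bound at hand has made \<open>\<mu>\<close>
  \<sigma>-finite.\<close>

lemma weak_bounded_averaged_iff:
  assumes \<sigma>: "\<sigma> > 1" and \<rho>: "0 < \<rho>" "\<rho> < 1" and q: "q > 1"
  shows "(\<exists>N>0. weak_bounded q N (\<lambda>\<xi>. \<integral>\<^sup>+z\<in>lusin_cone \<sigma> \<xi>. ennreal ((1 - cmod z) powr (p + 2)) \<partial>\<mu>))
    \<longleftrightarrow> (\<exists>N>0. weak_bounded q N (\<lambda>\<xi>. \<integral>\<^sup>+z\<in>lusin_cone \<sigma> \<xi>.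
           ennreal ((1 - cmod z) powr p) * emeasure \<mu> (pseudo_disk \<rho> z) \<partial>area_measure))"
    (is "(\<exists>N>0. weak_bounded q N (?A \<sigma>)) \<longleftrightarrow> (\<exists>N>0. weak_bounded q N ?B)")
proof
  have wm: "(\<lambda>z. ennreal ((1 - cmod z) powr (p + 2))) \<in> borel_measurable \<mu>"
    by (intro borel_measurable_disk weight_measurable)
  have Am: "?A \<sigma> \<in> borel_measurable borel" for \<sigma>
    by (rule cone_integral_measurable[OF wm])
  have Bm: "?B \<in> borel_measurable borel"
    by (rule averaged_cone_integral_measurable)
  {
    assume "\<exists>N>0. weak_bounded q N (?A \<sigma>)"
    then obtain N where N: "N > 0" "weak_bounded q N (?A \<sigma>)" by blast
    have sf: "sigma_finite_measure \<mu>"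
      using sigma_finite_if_weak_bounded_cone_integral[OF \<sigma> _ N(2)] q by simp
    define K where "K = 1 + 2 * \<rho> / (1 - \<rho>)"
    have K: "K \<ge> 1" using \<rho> by (simp add: K_def)
    have "1 * 1 < \<sigma> * K" using \<sigma> K by (intro mult_less_le_imp_less) auto
    then have \<sigma>': "\<sigma> * K + K > 1" using K by simp
    obtain N' where N': "N' > 0" "weak_bounded q N' (?A (\<sigma> * K + K))"
      using weak_bounded_change_aperture[OF sf wm \<sigma> \<sigma>' q N] by blast
    define c where "c = K powr \<bar>p\<bar> * K\<^sup>2"
    have c: "c > 0" using K by (simp add: c_def)
    have "weak_bounded q (c * N') ?B"
    proof (rule weak_bounded_mono_scaled[OF N'(2) Am Bm c])
      fix \<xi> :: complex assume \<xi>: "cmod \<xi> = 1"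
      have "?B \<xi> = (\<integral>\<^sup>+w. (\<integral>\<^sup>+z. averaging_kernel \<sigma> \<rho> p \<xi> z w \<partial>lborel) \<partial>\<mu>)"
        by (rule averaged_cone_integral_eq[OF sf])
      also have "\<dots> \<le> (\<integral>\<^sup>+w. ennreal c * (ennreal ((1 - cmod w) powr (p + 2)) * indicator (lusin_cone (\<sigma> * K + K) \<xi>) w) \<partial>\<mu>)"
        unfolding c_def K_def
        by (intro nn_integral_mono averaging_kernel_integral_le \<rho> \<sigma> \<xi>) (simp add: space_disk_measure unit_disk_def)
      also have "\<dots> = ennreal c * ?A (\<sigma> * K + K) \<xi>"
        by (intro nn_integral_cmult borel_measurable_times_ennreal wm indicator_cone_measurable)
      finally show "?B \<xi> \<le> ennreal c * ?A (\<sigma> * K + K) \<xi>" .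
    qed (use q in simp)
    then show "\<exists>N>0. weak_bounded q N ?B"
      using c N'(1) by (intro exI[of _ "c * N'"]) simp
  }
  {
    assume "\<exists>N>0. weak_bounded q N ?B"
    then obtain N where N: "N > 0" "weak_bounded q N ?B" by blast
    have sf: "sigma_finite_measure \<mu>"
      using sigma_finite_if_weak_bounded_averaged[OF \<sigma> \<rho>(1) _ N(2)] q by simp
    \<comment> \<open>The kernel estimate needs an aperture below \<open>\<sigma>\<close>, the
      change of aperture one above 1.\<close>
    define \<sigma>' where "\<sigma>' = (1 + \<sigma>) / 2"
    have \<sigma>': "1 < \<sigma>'" "\<sigma>' < \<sigma>" using \<sigma> by (auto simp: \<sigma>'_def)
    have "0 < \<sigma>'" using \<sigma>' by simp
    then obtain c where c: "c > 0" and ker: "\<And>\<xi> w. cmod \<xi> = 1 \<Longrightarrow> w \<in> lusin_cone \<sigma>' \<xi> \<Longrightarrow>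
       ennreal ((1 - cmod w) powr (p + 2)) \<le> ennreal c * (\<integral>\<^sup>+z. averaging_kernel \<sigma> \<rho> p \<xi> z w \<partial>lborel)"
      using averaging_kernel_integral_ge[OF \<rho>(1) \<sigma> _ \<sigma>'(2), of p] by blast
    have "weak_bounded q (c * N) (?A \<sigma>')"
    proof (rule weak_bounded_mono_scaled[OF N(2) Bm Am c])
      fix \<xi> :: complex assume \<xi>: "cmod \<xi> = 1"
      have "?A \<sigma>' \<xi> \<le> (\<integral>\<^sup>+w. ennreal c * (\<integral>\<^sup>+z. averaging_kernel \<sigma> \<rho> p \<xi> z w \<partial>lborel) \<partial>\<mu>)"
      proof (rule nn_integral_mono)
        fix w
        show "ennreal ((1 - cmod w) powr (p + 2)) * indicator (lusin_cone \<sigma>' \<xi>) w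
          \<le> ennreal c * (\<integral>\<^sup>+z. averaging_kernel \<sigma> \<rho> p \<xi> z w \<partial>lborel)"
          using ker[OF \<xi>, of w] by (cases "w \<in> lusin_cone \<sigma>' \<xi>") auto
      qed
      also have "\<dots> = ennreal c * (\<integral>\<^sup>+w. (\<integral>\<^sup>+z. averaging_kernel \<sigma> \<rho> p \<xi> z w \<partial>lborel) \<partial>\<mu>)"
        by (intro nn_integral_cmult borel_measurable_disk averaging_kernel_integral_measurable)
      also have "(\<integral>\<^sup>+w. (\<integral>\<^sup>+z. averaging_kernel \<sigma> \<rho> p \<xi> z w \<partial>lborel) \<partial>\<mu>) = ?B \<xi>"
        by (rule averaged_cone_integral_eq[OF sf, symmetric])
      finally show "?A \<sigma>' \<xi> \<le> ennreal c * ?B \<xi>" .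
    qed (use q in simp)
    moreover have "c * N > 0" using c N by simp
    ultimately show "\<exists>N>0. weak_bounded q N (?A \<sigma>)"
      using weak_bounded_change_aperture[OF sf wm \<sigma>'(1) \<sigma> q] by blast
  }
qed

text \<open>One direction is the pointwise bound |f| \<le> M (1 - |z|)^(-\<beta>). For the other,
  the hypothesis is applied to the three test functions, and the weak bounds for their integrals are
  added.\<close>

lemma weak_bounded_growth_space_iff:
  assumes \<beta>: "\<beta> > 0" and q: "q > 1"
  shows "(\<exists>C>0. \<forall>f. f holomorphic_on unit_disk \<longrightarrow>
            weak_Lq_norm q (\<lambda>\<xi>. \<integral>\<^sup>+ z\<in>lusin_cone \<sigma> \<xi>.
                 ennreal ((1 - cmod z) powr t * cmod (f z) / (1 - cmod z)) \<partial>\<mu>)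
            \<le> ennreal C * (SUP z\<in>unit_disk. ennreal (cmod (f z) * (1 - cmod z) powr \<beta>)))
    \<longleftrightarrow> (\<exists>N>0. weak_bounded q N (\<lambda>\<xi>. \<integral>\<^sup>+z\<in>lusin_cone \<sigma> \<xi>. ennreal ((1 - cmod z) powr (t - 1 - \<beta>)) \<partial>\<mu>))"
    (is "(\<exists>C>0. \<forall>f. _ \<longrightarrow> weak_Lq_norm q (?G f) \<le> ennreal C * ?S f) \<longleftrightarrow> (\<exists>N>0. weak_bounded q N ?A)")
proof
  have wm: "(\<lambda>z. ennreal ((1 - cmod z) powr (t - 1 - \<beta>))) \<in> borel_measurable \<mu>"
    by (intro borel_measurable_disk weight_measurable)
  have Am: "?A \<in> borel_measurable borel"
    by (rule cone_integral_measurable[OF wm])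
  have gm: "(\<lambda>z. ennreal ((1 - cmod z) powr t * cmod (f z) / (1 - cmod z))) \<in> borel_measurable \<mu>"
    if "f holomorphic_on unit_disk" for f
  proof -
    have [measurable]: "f \<in> borel_measurable \<mu>"
      using that by (intro borel_measurable_disk_continuous_on holomorphic_on_imp_continuous_on)
    have [measurable]: "(\<lambda>z. cmod z) \<in> borel_measurable \<mu>"
      by (intro borel_measurable_disk) simp
    show ?thesis by measurable
  qed
  have Gm: "?G f \<in> borel_measurable borel" if "f holomorphic_on unit_disk" for f
    by (rule cone_integral_measurable[OF gm[OF that]])
  {
    assume "\<exists>C>0. \<forall>f. f holomorphic_on unit_disk \<longrightarrow> weak_Lq_norm q (?G f) \<le> ennreal C * ?S f"
    then obtain C where C: "C > 0"
      and hyp: "\<And>f. f holomorphic_on unit_disk \<Longrightarrow> weak_Lq_norm q (?G f) \<le> ennreal C * ?S f" by blast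
    obtain f1 f2 K c where hol: "f1 holomorphic_on unit_disk" "f2 holomorphic_on unit_disk"
      and K: "K > 0" and c: "c > 0"
      and up: "\<And>z. z \<in> unit_disk \<Longrightarrow> cmod (f1 z) * (1 - cmod z) powr \<beta> \<le> K"
        "\<And>z. z \<in> unit_disk \<Longrightarrow> cmod (f2 z) * (1 - cmod z) powr \<beta> \<le> K"
      and low: "\<And>z. z \<in> unit_disk \<Longrightarrow> (1 - cmod z) powr (- \<beta>) \<le> c * (cmod (f1 z) + cmod (f2 z) + 1)"
      by (rule growth_space_test_functions[OF \<beta>]) blast
    have bd: "weak_bounded q (C * L) (?G f)"
      if f: "f holomorphic_on unit_disk" and L: "L > 0"
        and le: "\<And>z. z \<in> unit_disk \<Longrightarrow> cmod (f z) * (1 - cmod z) powr \<beta> \<le> L" for f L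
    proof -
      have "?S f \<le> ennreal L" by (intro SUP_least ennreal_leI le)
      then have "ennreal C * ?S f \<le> ennreal C * ennreal L" by (intro mult_left_mono) auto
      then have "weak_Lq_norm q (?G f) \<le> ennreal (C * L)"
        using hyp[OF f] C L by (simp add: ennreal_mult)
      then show ?thesis using C L by (simp add: weak_Lq_norm_le_iff)
    qed
    have h1: "(\<lambda>z. 1 :: complex) holomorphic_on unit_disk" by simp
    have b3: "weak_bounded q (C * 1) (?G (\<lambda>z. 1))"
      using \<beta> by (intro bd h1) (auto simp: unit_disk_def powr_le1)
    have b12: "weak_bounded q (4 * (C * K + C * K)) (\<lambda>\<xi>. ?G f1 \<xi> + ?G f2 \<xi>)"
      by (rule weak_bounded_add[OF bd[OF hol(1) K up(1)] bd[OF hol(2) K up(2)] Gm[OF hol(1)] Gm[OF hol(2)] q])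
    have Gm12: "(\<lambda>\<xi>. ?G f1 \<xi> + ?G f2 \<xi>) \<in> borel_measurable borel"
      by (intro borel_measurable_add Gm hol)
    define N where "N = 4 * (4 * (C * K + C * K) + C * 1)"
    have N: "N > 0" using C K by (simp add: N_def add_pos_pos)
    have b123: "weak_bounded q N (\<lambda>\<xi>. (?G f1 \<xi> + ?G f2 \<xi>) + ?G (\<lambda>z. 1) \<xi>)"
      unfolding N_def by (rule weak_bounded_add[OF b12 b3 Gm12 Gm[OF h1] q])
    have "weak_bounded q (c * N) ?A"
    proof (rule weak_bounded_mono_scaled[OF b123 _ Am c])
      show "(\<lambda>\<xi>. (?G f1 \<xi> + ?G f2 \<xi>) + ?G (\<lambda>z. 1) \<xi>) \<in> borel_measurable borel"
        by (intro borel_measurable_add Gm hol h1)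
      fix \<xi> :: complex
      let ?w = "\<lambda>f z. ennreal ((1 - cmod z) powr t * cmod (f z) / (1 - cmod z)) * indicator (lusin_cone \<sigma> \<xi>) z"
      have wm': "?w f \<in> borel_measurable \<mu>" if "f holomorphic_on unit_disk" for f
        by (intro borel_measurable_times_ennreal gm[OF that] indicator_cone_measurable)
      have "?A \<xi> \<le> (\<integral>\<^sup>+z. ennreal c * (?w f1 z + ?w f2 z + ?w (\<lambda>z. 1) z) \<partial>\<mu>)"
      proof (rule nn_integral_mono)
        fix z
        show "ennreal ((1 - cmod z) powr (t - 1 - \<beta>)) * indicator (lusin_cone \<sigma> \<xi>) z
          \<le> ennreal c * (?w f1 z + ?w f2 z + ?w (\<lambda>z. 1) z)"
        proof (cases "z \<in> lusin_cone \<sigma> \<xi>")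
          case True
          then have zD: "z \<in> unit_disk" by (simp add: lusin_cone_def)
          define x where "x = 1 - cmod z"
          have x: "x > 0" using zD by (simp add: x_def unit_disk_def)
          define u where "u = x powr t / x"
          have u: "u > 0" using x by (simp add: u_def)
          have "x powr (t - 1 - \<beta>) = u * x powr (- \<beta>)"
          proof -
            have "u = x powr (t - 1)" using x by (simp add: u_def powr_diff)
            then show ?thesis by (simp flip: powr_add)
          qed
          also have "\<dots> \<le> u * (c * (cmod (f1 z) + cmod (f2 z) + 1))"
            using low[OF zD] u by (intro mult_left_mono) (auto simp: x_def)
          finally have "x powr (t - 1 - \<beta>) \<le> c * (u * cmod (f1 z) + u * cmod (f2 z) + u)"
            by (simp add: algebra_simps)
          then have "ennreal (x powr (t - 1 - \<beta>)) \<le> ennreal (c * (u * cmod (f1 z) + u * cmod (f2 z) + u))"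
            by (rule ennreal_leI)
          also have "\<dots> = ennreal c * (ennreal (u * cmod (f1 z)) + ennreal (u * cmod (f2 z)) + ennreal u)"
            using c u by (simp add: ennreal_mult ennreal_plus)
          finally show ?thesis using True by (simp add: x_def u_def)
        qed simp
      qed
      also have "\<dots> = ennreal c * (?G f1 \<xi> + ?G f2 \<xi> + ?G (\<lambda>z. 1) \<xi>)"
        using wm'[OF hol(1)] wm'[OF hol(2)] wm'[OF h1]
        by (simp add: nn_integral_cmult nn_integral_add)
      finally show "?A \<xi> \<le> ennreal c * (?G f1 \<xi> + ?G f2 \<xi> + ?G (\<lambda>z. 1) \<xi>)" .
    qed (use q in simp)
    then show "\<exists>N>0. weak_bounded q N ?A"
      using c N by (intro exI[of _ "c * N"]) simp
  }
  {
    assume "\<exists>N>0. weak_bounded q N ?A"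
    then obtain N where N: "N > 0" "weak_bounded q N ?A" by blast
    have "weak_Lq_norm q (?G f) \<le> ennreal N * ?S f" if f: "f holomorphic_on unit_disk" for f
    proof (cases "?S f")
      case top
      show ?thesis unfolding top using N(1) by (simp add: ennreal_mult_top)
    next
      case (real M)
      have le: "cmod (f z) * (1 - cmod z) powr \<beta> \<le> M" if "z \<in> unit_disk" for z
      proof -
        have "ennreal (cmod (f z) * (1 - cmod z) powr \<beta>) \<le> ennreal M"
          unfolding real(2)[symmetric] by (rule SUP_upper[OF that])
        then show ?thesis using real(1) by simp
      qed
      have GA: "?G f \<xi> \<le> ennreal M * ?A \<xi>" for \<xi>
      proof -
        have "?G f \<xi> \<le> (\<integral>\<^sup>+z. ennreal M * (ennreal ((1 - cmod z) powr (t - 1 - \<beta>)) * indicator (lusin_cone \<sigma> \<xi>) z) \<partial>\<mu>)"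
        proof (rule nn_integral_mono)
          fix z
          show "ennreal ((1 - cmod z) powr t * cmod (f z) / (1 - cmod z)) * indicator (lusin_cone \<sigma> \<xi>) z
            \<le> ennreal M * (ennreal ((1 - cmod z) powr (t - 1 - \<beta>)) * indicator (lusin_cone \<sigma> \<xi>) z)"
          proof (cases "z \<in> lusin_cone \<sigma> \<xi>")
            case True
            then have zD: "z \<in> unit_disk" by (simp add: lusin_cone_def)
            define x where "x = 1 - cmod z"
            have x: "x > 0" using zD by (simp add: x_def unit_disk_def)
            have "x powr (t - 1 - \<beta>) * x powr \<beta> = x powr (t - 1)"
              by (simp flip: powr_add)
            also have "\<dots> = x powr t / x" using x by (simp add: powr_diff)
            finally have "x powr t * cmod (f z) / x = x powr (t - 1 - \<beta>) * (cmod (f z) * x powr \<beta>)"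
              by (simp add: mult_ac)
            also have "\<dots> \<le> x powr (t - 1 - \<beta>) * M"
              using le[OF zD] by (intro mult_left_mono) (auto simp: x_def)
            finally have "ennreal (x powr t * cmod (f z) / x) \<le> ennreal (M * x powr (t - 1 - \<beta>))"
              by (intro ennreal_leI) (simp add: mult.commute)
            then show ?thesis using True real(1) by (simp add: x_def ennreal_mult)
          qed simp
        qed
        also have "\<dots> = ennreal M * ?A \<xi>"
          by (intro nn_integral_cmult borel_measurable_times_ennreal wm indicator_cone_measurable)
        finally show ?thesis .
      qed
      \<comment> \<open>\<open>weak_bounded_mono_scaled\<close> takes a positive factor, so
        vanishing \<open>M\<close>, where the integral is identically 0, is treated apart.\<close>
      have "weak_bounded q (M * N) (?G f)"
      proof (cases "M = 0")
        case True
        then have "?G f \<xi> = 0" for \<xi> using GA[of \<xi>] by simp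
        then show ?thesis using True by (simp add: weak_bounded_def)
      next
        case False
        then have "M > 0" using real(1) by simp
        then show ?thesis
          using q by (intro weak_bounded_mono_scaled[OF N(2) Am Gm[OF f]] GA) auto
      qed
      then have "weak_Lq_norm q (?G f) \<le> ennreal (M * N)"
        using N real(1) by (subst weak_Lq_norm_le_iff) auto
      then show ?thesis
        unfolding real(2) using N(1) real(1) by (simp add: ennreal_mult mult.commute)
    qed
    then show "\<exists>C>0. \<forall>f. f holomorphic_on unit_disk \<longrightarrow> weak_Lq_norm q (?G f) \<le> ennreal C * ?S f"
      using N(1) by blast
  }
qed

end

theorem theorem2:
  fixes \<beta> q t \<sigma> \<tau> :: real and \<mu> :: "complex measure"
  assumes "\<beta> > 0" and "q > 1" and "t > \<beta> + 1" and "\<sigma> > 1" and "\<tau> > 0"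
    and "sets \<mu> = sets (restrict_space borel unit_disk)"
  shows "(\<exists>C>0. \<forall>f. f holomorphic_on unit_disk \<longrightarrow>
            weak_Lq_norm q (\<lambda>\<xi>. \<integral>\<^sup>+ z\<in>lusin_cone \<sigma> \<xi>.
                 ennreal ((1 - cmod z) powr t * cmod (f z) / (1 - cmod z)) \<partial>\<mu>)
            \<le> ennreal C * (SUP z\<in>unit_disk. ennreal (cmod (f z) * (1 - cmod z) powr \<beta>)))
         \<longleftrightarrow>
         weak_Lq_norm q (\<lambda>\<xi>. \<integral>\<^sup>+ z\<in>lusin_cone \<sigma> \<xi>.
                 ennreal ((1 - cmod z) powr (t - 1)) * emeasure \<mu> (bergman_disk z \<tau>)
                 * ennreal ((1 - cmod z) powr (- \<beta>) / (1 - cmod z)^2) \<partial>area_measure) < \<infinity>"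
proof -
  interpret disk_measure \<mu>
    using assms(6) by unfold_locales
  \<comment> \<open>The exponents t - 1, -\<beta> and -2 of the averaged integrand combined; the
    area of the disks returns 2, which leaves t - 1 - \<beta>.\<close>
  define p where "p = t - 3 - \<beta>"
  have \<rho>: "0 < tanh \<tau>" "tanh \<tau> < 1"
    using assms(5) tanh_real_lt_1[of \<tau>] by auto
  have "ennreal ((1 - cmod z) powr (t - 1)) * emeasure \<mu> (bergman_disk z \<tau>)
          * ennreal ((1 - cmod z) powr (- \<beta>) / (1 - cmod z)^2) * indicator (lusin_cone \<sigma> \<xi>) z
      = ennreal ((1 - cmod z) powr p) * emeasure \<mu> (pseudo_disk (tanh \<tau>) z) * indicator (lusin_cone \<sigma> \<xi>) z"
    for \<xi> z
  proof (cases "z \<in> lusin_cone \<sigma> \<xi>")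
    case True
    then have zD: "z \<in> unit_disk" by (simp add: lusin_cone_def)
    define x where "x = 1 - cmod z"
    have x: "x > 0" using zD by (simp add: x_def unit_disk_def)
    have "x powr p = x powr (t - 1 + - \<beta> + - 2)"
      by (simp add: p_def algebra_simps)
    also have "\<dots> = x powr (t - 1) * (x powr (- \<beta>) / x\<^sup>2)"
      using x by (simp only: powr_add powr_minus[of x 2]) (simp add: field_simps)
    finally have "ennreal (x powr p) = ennreal (x powr (t - 1)) * ennreal (x powr (- \<beta>) / x\<^sup>2)"
      by (simp only: ennreal_mult'[OF powr_ge_zero])
    then show ?thesis
      by (simp add: x_def bergman_disk_eq_pseudo_disk[OF zD] mult_ac)
  qed simp
  then have "weak_Lq_norm q (\<lambda>\<xi>. \<integral>\<^sup>+ z\<in>lusin_cone \<sigma> \<xi>.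
                 ennreal ((1 - cmod z) powr (t - 1)) * emeasure \<mu> (bergman_disk z \<tau>)
                 * ennreal ((1 - cmod z) powr (- \<beta>) / (1 - cmod z)^2) \<partial>area_measure) < \<infinity>
     \<longleftrightarrow> (\<exists>N>0. weak_bounded q N (\<lambda>\<xi>. \<integral>\<^sup>+z\<in>lusin_cone \<sigma> \<xi>.
           ennreal ((1 - cmod z) powr p) * emeasure \<mu> (pseudo_disk (tanh \<tau>) z) \<partial>area_measure))"
    by (simp only: weak_Lq_norm_finite_iff)
  also have "\<dots> \<longleftrightarrow> (\<exists>N>0. weak_bounded q N (\<lambda>\<xi>. \<integral>\<^sup>+z\<in>lusin_cone \<sigma> \<xi>. ennreal ((1 - cmod z) powr (p + 2)) \<partial>\<mu>))"
    by (rule weak_bounded_averaged_iff[OF assms(4) \<rho> assms(2), symmetric])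
  also have "p + 2 = t - 1 - \<beta>"
    by (simp add: p_def)
  finally show ?thesis
    using weak_bounded_growth_space_iff[OF assms(1,2), of t \<sigma>] by simp
qed

end
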